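(* Let $X$ be a compact metric space and let $\mathcal L_R$ be a finite language containing a distinguished binary relation symbol $R$. Suppose $\mathcal F$ is an at most countable projective Fraïssé family of finite topological $\mathcal L_R$-structures with projective Fraïssé limit $\mathbb F$, such that $R^{\mathbb F}$ is an equivalence relation, and let $\Phi:X\to \mathbb F/R^{\mathbb F}$ be a homeomorphism (so $X$ is finitely representable, witnessed by $\mathcal L_R$ and $\Phi$). Let $\pi:\mathbb F\to\mathbb F/R^{\mathbb F}$ be the quotient map, and let $G\subseteq\mathbb F$ be the set of all almost stable points of $\mathbb F$. Let $\equiv$ be a closed equivalence relation on $\mathbb F$ such that $R^{\mathbb F}\subseteq{\equiv}$ and ${\equiv}\setminus G^2=R^{\mathbb F}\setminus G^2$. Define the equivalence relation $\cong$ on $X$ by $$x\cong y\iff \exists u,v\in\mathbb F\ (u\equiv v\ \wedge\ \pi(u)=\Phi(x)\ \wedge\ \pi(v)=\Phi(y)).$$ Then the quotient space $X/{\cong}$ is finitely representable.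
   Context: Let $\mathcal L$ be a first-order language. A topological $\mathcal L$-structure is a zero-dimensional, compact, Hausdorff, second countable space which is also an $\mathcal L$-structure, with relation symbols interpreted as closed sets and function symbols as continuous functions. An epimorphism between topological $\mathcal L$-structures $A,B$ is a continuous surjection $\varphi:A\to B$ such that $r^B=(\varphi\times\cdots\times\varphi)(r^A)$ for every relation symbol $r$, $f^B(\varphi(a_1),\ldots,\varphi(a_n))=\varphi(f^A(a_1,\ldots,a_n))$ for every $n$-ary function symbol $f$, and $\varphi(c^A)=c^B$ for every constant symbol $c$. An isomorphism is a bijective epimorphism. A family $\mathcal F$ of topological $\mathcal L$-structures is a projective Fraïssé family if (JPP) for all $D,E\in\mathcal F$ there are $F\in\mathcal F$ and epimorphisms $F\to D$, $F\to E$, and (AP) for all $C,D,E\in\mathcal F$ and epimorphisms $\varphi_1:D\to C$, $\varphi_2:E\to C$ there are $F\in\mathcal F$ and epimorphisms $\psi_1:F\to D$, $\psi_2:F\to E$ with $\varphi_1\psi_1=\varphi_2\psi_2$. A topological $\mathcal L$-structure $\mathbb F$ is a projective Fraïssé limit of $\mathcal F$ if (L1) for every $D\in\mathcal F$ there is an epimorphism $\mathbb F\to D$; (L2) for every finite discrete space $A$ and continuous $f:\mathbb F\to A$ there are $D\in\mathcal F$, an epimorphism $\varphi:\mathbb F\to D$ and a function $f':D\to A$ with $f=f'\varphi$; (L3) for every $D\in\mathcal F$ and epimorphisms $\varphi_1,\varphi_2:\mathbb F\to D$ there is an isomorphism $\psi:\mathbb F\to\mathbb F$ with $\varphi_2=\varphi_1\psi$.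 Every non-empty, at most countable projective Fraïssé family of finite topological $\mathcal L$-structures has a projective Fraïssé limit, unique up to isomorphism. When $R^{\mathbb F}$ is an equivalence relation, a point $x\in\mathbb F$ is almost stable if $\varphi(x)\,R^{\mathbb F}\,x$ for every isomorphism $\varphi:\mathbb F\to\mathbb F$. For a language $\mathcal L_R$ containing a distinguished binary relation symbol $R$, a compact metric space $Y$ is $\mathcal L_R$-representable if there is an at most countable projective Fraïssé family of finite topological $\mathcal L_R$-structures whose projective Fraïssé limit $\mathbb F$ has $R^{\mathbb F}$ an equivalence relation and $\mathbb F/R^{\mathbb F}$ homeomorphic to $Y$. $Y$ is finitely representable if it is $\mathcal L_R$-representable for some finite such $\mathcal L_R$. *)

theory Defs
  imports "HOL-Analysis.Analysis"
begin

section \<open>Languages and topological structures\<close>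

record ('r, 'f, 'c) language =
  rel_syms :: "'r set"
  rel_arity :: "'r \<Rightarrow> nat"
  fun_syms :: "'f set"
  fun_arity :: "'f \<Rightarrow> nat"
  const_syms :: "'c set"

definition finite_language :: "('r, 'f, 'c) language \<Rightarrow> bool" where
  "finite_language L \<longleftrightarrow> finite (rel_syms L) \<and> finite (fun_syms L) \<and> finite (const_syms L)"

definition binary_rel_symbol :: "('r, 'f, 'c) language \<Rightarrow> 'r \<Rightarrow> bool" where
  "binary_rel_symbol L R \<longleftrightarrow> R \<in> rel_syms L \<and> rel_arity L R = 2"

text \<open>The carrier of a structure is the \<^const>\<open>topspace\<close> of its topology. An \<open>n\<close>-tuple is an
  extensional function on \<open>{..<n}\<close>, so that the \<open>n\<close>-th power of a space is a
  \<^const>\<open>product_topology\<close>. The interpretations are only meaningful for the symbols of the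
  language (and, for function symbols, on tuples from the carrier).\<close>

record ('r, 'f, 'c, 'a) struct =
  top_of :: "'a topology"
  rel_of :: "'r \<Rightarrow> (nat \<Rightarrow> 'a) set"
  fun_of :: "'f \<Rightarrow> (nat \<Rightarrow> 'a) \<Rightarrow> 'a"
  const_of :: "'c \<Rightarrow> 'a"

abbreviation carrier_of :: "('r, 'f, 'c, 'a) struct \<Rightarrow> 'a set" where
  "carrier_of A \<equiv> topspace (top_of A)"

abbreviation power_topology :: "nat \<Rightarrow> 'a topology \<Rightarrow> (nat \<Rightarrow> 'a) topology" where
  "power_topology n X \<equiv> product_topology (\<lambda>_. X) {..<n}"

definition map_tuple :: "nat \<Rightarrow> ('a \<Rightarrow> 'b) \<Rightarrow> (nat \<Rightarrow> 'a) \<Rightarrow> (nat \<Rightarrow> 'b)" where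
  "map_tuple n \<phi> a = (\<lambda>i\<in>{..<n}. \<phi> (a i))"

definition topological_structure ::
    "('r, 'f, 'c) language \<Rightarrow> ('r, 'f, 'c, 'a) struct \<Rightarrow> bool" where
  "topological_structure L A \<longleftrightarrow>
     top_of A dim_le 0 \<and> compact_space (top_of A) \<and> Hausdorff_space (top_of A) \<and>
     second_countable (top_of A) \<and>
     (\<forall>r\<in>rel_syms L. closedin (power_topology (rel_arity L r) (top_of A)) (rel_of A r)) \<and>
     (\<forall>f\<in>fun_syms L.
        continuous_map (power_topology (fun_arity L f) (top_of A)) (top_of A) (fun_of A f)) \<and>
     (\<forall>c\<in>const_syms L. const_of A c \<in> carrier_of A)"

definition binary_rel_of :: "('r, 'f, 'c, 'a) struct \<Rightarrow> 'r \<Rightarrow> ('a \<times> 'a) set" where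
  "binary_rel_of A R = (\<lambda>a. (a 0, a 1)) ` rel_of A R"

definition epimorphism ::
    "('r, 'f, 'c) language \<Rightarrow> ('r, 'f, 'c, 'a) struct \<Rightarrow> ('r, 'f, 'c, 'b) struct \<Rightarrow>
     ('a \<Rightarrow> 'b) \<Rightarrow> bool" where
  "epimorphism L A B \<phi> \<longleftrightarrow>
     continuous_map (top_of A) (top_of B) \<phi> \<and> \<phi> ` carrier_of A = carrier_of B \<and>
     (\<forall>r\<in>rel_syms L. rel_of B r = map_tuple (rel_arity L r) \<phi> ` rel_of A r) \<and>
     (\<forall>f\<in>fun_syms L. \<forall>a\<in>topspace (power_topology (fun_arity L f) (top_of A)).
        fun_of B f (map_tuple (fun_arity L f) \<phi> a) = \<phi> (fun_of A f a)) \<and>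
     (\<forall>c\<in>const_syms L. \<phi> (const_of A c) = const_of B c)"

definition isomorphism ::
    "('r, 'f, 'c) language \<Rightarrow> ('r, 'f, 'c, 'a) struct \<Rightarrow> ('r, 'f, 'c, 'b) struct \<Rightarrow>
     ('a \<Rightarrow> 'b) \<Rightarrow> bool" where
  "isomorphism L A B \<phi> \<longleftrightarrow> epimorphism L A B \<phi> \<and> bij_betw \<phi> (carrier_of A) (carrier_of B)"


section \<open>Projective Fraisse families and their limits\<close>

definition projective_Fraisse_family ::
    "('r, 'f, 'c) language \<Rightarrow> ('r, 'f, 'c, 'd) struct set \<Rightarrow> bool" where
  "projective_Fraisse_family L \<F> \<longleftrightarrow>
     (\<forall>D\<in>\<F>. topological_structure L D) \<and>
     (\<forall>D\<in>\<F>. \<forall>E\<in>\<F>. \<exists>F\<in>\<F>. (\<exists>\<phi>. epimorphism L F D \<phi>) \<and> (\<exists>\<psi>. epimorphism L F E \<psi>)) \<and>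
     (\<forall>C\<in>\<F>. \<forall>D\<in>\<F>. \<forall>E\<in>\<F>. \<forall>\<phi>\<^sub>1 \<phi>\<^sub>2. epimorphism L D C \<phi>\<^sub>1 \<and> epimorphism L E C \<phi>\<^sub>2 \<longrightarrow>
        (\<exists>F\<in>\<F>. \<exists>\<psi>\<^sub>1 \<psi>\<^sub>2. epimorphism L F D \<psi>\<^sub>1 \<and> epimorphism L F E \<psi>\<^sub>2 \<and>
           (\<forall>x\<in>carrier_of F. \<phi>\<^sub>1 (\<psi>\<^sub>1 x) = \<phi>\<^sub>2 (\<psi>\<^sub>2 x))))"

text \<open>In the second limit condition the finite discrete spaces are, up to bijection, the finite
  sets of natural numbers.\<close>

definition projective_Fraisse_limit ::
    "('r, 'f, 'c) language \<Rightarrow> ('r, 'f, 'c, 'd) struct set \<Rightarrow> ('r, 'f, 'c, 'a) struct \<Rightarrow> bool" where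
  "projective_Fraisse_limit L \<F> \<FF> \<longleftrightarrow>
     topological_structure L \<FF> \<and>
     (\<forall>D\<in>\<F>. \<exists>\<phi>. epimorphism L \<FF> D \<phi>) \<and>
     (\<forall>(A::nat set) f. finite A \<and> continuous_map (top_of \<FF>) (discrete_topology A) f \<longrightarrow>
        (\<exists>D\<in>\<F>. \<exists>\<phi> f'. epimorphism L \<FF> D \<phi> \<and> f' \<in> carrier_of D \<rightarrow> A \<and>
           (\<forall>x\<in>carrier_of \<FF>. f x = f' (\<phi> x)))) \<and>
     (\<forall>D\<in>\<F>. \<forall>\<phi>\<^sub>1 \<phi>\<^sub>2. epimorphism L \<FF> D \<phi>\<^sub>1 \<and> epimorphism L \<FF> D \<phi>\<^sub>2 \<longrightarrow>
        (\<exists>\<psi>. isomorphism L \<FF> \<FF> \<psi> \<and> (\<forall>x\<in>carrier_of \<FF>. \<phi>\<^sub>2 x = \<phi>\<^sub>1 (\<psi> x))))"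

definition almost_stable ::
    "('r, 'f, 'c) language \<Rightarrow> 'r \<Rightarrow> ('r, 'f, 'c, 'a) struct \<Rightarrow> 'a \<Rightarrow> bool" where
  "almost_stable L R \<FF> x \<longleftrightarrow>
     x \<in> carrier_of \<FF> \<and> (\<forall>\<phi>. isomorphism L \<FF> \<FF> \<phi> \<longrightarrow> (\<phi> x, x) \<in> binary_rel_of \<FF> R)"


section \<open>Quotient spaces and representability\<close>

definition quotient_space :: "'a topology \<Rightarrow> ('a \<times> 'a) set \<Rightarrow> 'a set topology" where
  "quotient_space X E =
     topology (\<lambda>U. U \<subseteq> topspace X // E \<and> openin X {x \<in> topspace X. E `` {x} \<in> U})"

lemma openin_quotient_space:
  "openin (quotient_space X E) U \<longleftrightarrow>
     U \<subseteq> topspace X // E \<and> openin X {x \<in> topspace X. E `` {x} \<in> U}"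
proof -
  have int: "{x \<in> topspace X. E `` {x} \<in> S \<inter> T} =
      {x \<in> topspace X. E `` {x} \<in> S} \<inter> {x \<in> topspace X. E `` {x} \<in> T}" for S T
    by auto
  have un: "{x \<in> topspace X. E `` {x} \<in> \<Union>K} = (\<Union>S\<in>K. {x \<in> topspace X. E `` {x} \<in> S})" for K
    by auto
  have "istopology (\<lambda>U. U \<subseteq> topspace X // E \<and> openin X {x \<in> topspace X. E `` {x} \<in> U})"
    unfolding istopology_def int un by (auto intro!: openin_Int openin_Union)
  then show ?thesis
    by (simp add: quotient_space_def topology_inverse')
qed

lemma topspace_quotient_space: "topspace (quotient_space X E) = topspace X // E"
proof -
  have "{x \<in> topspace X. E `` {x} \<in> topspace X // E} = topspace X"
    by (auto intro: quotientI)
  then have "openin (quotient_space X E) (topspace X // E)"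
    by (simp add: openin_quotient_space)
  then show ?thesis
    by (meson openin_quotient_space openin_subset openin_topspace subset_antisym)
qed

lemma quotient_map_quotient_space: "quotient_map X (quotient_space X E) (\<lambda>x. E `` {x})"
  by (auto simp: quotient_map_def topspace_quotient_space openin_quotient_space quotient_def)

text \<open>Up to isomorphism nothing is lost by the choice of types for the bound variables below:
  a finite structure can be carried by natural numbers, a zero-dimensional compact Hausdorff
  second countable space embeds into the Cantor space, and a finite language can be given
  symbols that are natural numbers. As the limit of the family is unique up to isomorphism,
  it may be quantified existentially.\<close>

definition representable :: "('r, 'f, 'c) language \<Rightarrow> 'r \<Rightarrow> 'y topology \<Rightarrow> bool" where
  "representable L R Y \<longleftrightarrow>
     compact_space Y \<and> metrizable_space Y \<and>
     (\<exists>(\<F> :: ('r, 'f, 'c, nat) struct set) (\<FF> :: ('r, 'f, 'c, nat \<Rightarrow> bool) struct).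
        countable \<F> \<and> (\<forall>D\<in>\<F>. finite (carrier_of D)) \<and>
        projective_Fraisse_family L \<F> \<and> projective_Fraisse_limit L \<F> \<FF> \<and>
        equiv (carrier_of \<FF>) (binary_rel_of \<FF> R) \<and>
        quotient_space (top_of \<FF>) (binary_rel_of \<FF> R) homeomorphic_space Y)"

definition finitely_representable :: "'y topology \<Rightarrow> bool" where
  "finitely_representable Y \<longleftrightarrow>
     (\<exists>(L :: (nat, nat, nat) language) R.
        finite_language L \<and> binary_rel_symbol L R \<and> representable L R Y)"

end

theory Submission
  imports Defs
begin

text \<open>
  Every automorphism \<open>\<psi>\<close> of the limit \<open>\<FF>\<close> preserves \<open>E\<close>: off \<open>G \<times> G\<close> the relation \<open>E\<close> is \<open>R\<close>, and
  for almost stable \<open>u\<close>, \<open>v\<close> one has \<open>\<psi> u R u E v R \<psi> v\<close>. By (L3) the image of \<open>E\<close> under an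
  epimorphism \<open>\<FF> \<rightarrow> D\<close> therefore depends on \<open>D\<close> only. Interpreting a new binary symbol by \<open>E\<close> in \<open>\<FF>\<close>
  and by these images in the members of the family leaves all epimorphisms unchanged, so the expanded
  \<open>\<FF>\<close> is the limit of the expanded family. With the new symbol as the distinguished one, its quotient
  is \<open>\<FF> / E\<close>, which is homeomorphic to \<open>X / C\<close>.
\<close>

section \<open>Quotients of compact spaces\<close>

text \<open>The space \<open>Y\<close> is compact and Hausdorff, so a continuous injection of it
  into a countable product of real lines is already an embedding, and subspaces of such a product
  are metrizable. The countability of the index set is drawn from a base of
  \<open>X\<close>.\<close>

lemma metrizable_space_continuous_image:
  assumes q: "continuous_map X Y q" "q ` topspace X = topspace Y"
    and X: "compact_space X" "second_countable X" and Y: "Hausdorff_space Y"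
  shows "metrizable_space Y"
proof -
  obtain \<B> where \<B>: "countable \<B>" "\<And>V. V \<in> \<B> \<Longrightarrow> openin X V"
      "\<And>U x. openin X U \<Longrightarrow> x \<in> U \<Longrightarrow> \<exists>V\<in>\<B>. x \<in> V \<and> V \<subseteq> U"
    using X(2) unfolding second_countable_def by metis
  have cY: "compact_space Y"
    using q X(1) by (metis compact_space_def image_compactin)
  have nY: "normal_space Y"
    using cY Y compact_Hausdorff_or_regular_imp_normal_space by blast
  \<comment> \<open>Points of \<open>Y\<close> are separated by countably many functions, one for each pair of basic open
    sets of \<open>X\<close> that some continuous function on \<open>Y\<close> tells apart.\<close>
  define P where "P = (\<lambda>(A, B) f. continuous_map Y euclideanreal f \<and>
      (\<forall>x\<in>A. f (q x) < 1/3) \<and> (\<forall>x\<in>B. f (q x) > 2/3))"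
  define I where "I = {p \<in> \<B> \<times> \<B>. \<exists>f. P p f}"
  define g where "g = (\<lambda>p. SOME f. P p f)"
  have g: "P p (g p)" if "p \<in> I" for p
    using that unfolding I_def g_def by (simp add: someI_ex)
  define h where "h = (\<lambda>y. \<lambda>p\<in>I. g p y)"
  let ?Z = "product_topology (\<lambda>_. euclideanreal) I"
  have gc: "continuous_map Y euclideanreal (g p)" if "p \<in> I" for p
    using g[OF that] by (simp add: P_def case_prod_beta)
  have hc: "continuous_map Y ?Z h"
    unfolding continuous_map_componentwise h_def using gc by auto
  have hinj: "inj_on h (topspace Y)"
  proof (rule inj_onI, rule ccontr)
    fix y z assume y: "y \<in> topspace Y" and z: "z \<in> topspace Y" and eq: "h y = h z" and ne: "y \<noteq> z"
    have "closedin Y {y}" "closedin Y {z}"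
      using Y y z by (simp_all add: closedin_Hausdorff_singleton)
    then obtain f where f: "continuous_map Y euclideanreal f" "f ` {y} \<subseteq> {0::real}" "f ` {z} \<subseteq> {1}"
      using Urysohn_lemma_alt[OF nY, of "{y}" "{z}" 0 1] ne by auto
    obtain a b where a: "a \<in> topspace X" "q a = y" and b: "b \<in> topspace X" "q b = z"
      using q(2) y z by (metis imageE)
    have fq: "continuous_map X euclideanreal (f \<circ> q)"
      using q(1) f(1) by (rule continuous_map_compose)
    \<comment> \<open>The Urysohn function is pulled back to \<open>X\<close>, where basic sets are
      available. The thresholds 1/3 and 2/3 leave a gap, so that bounds on the basic sets alone keep
      the two points apart.\<close>
    have "openin X {x \<in> topspace X. (f \<circ> q) x \<in> {..<1/3}}" "openin X {x \<in> topspace X. (f \<circ> q) x \<in> {2/3<..}}"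
      by (rule openin_continuous_map_preimage[OF fq]; simp)+
    then obtain A B where AB: "A \<in> \<B>" "a \<in> A" "A \<subseteq> {x \<in> topspace X. (f \<circ> q) x \<in> {..<1/3}}"
       "B \<in> \<B>" "b \<in> B" "B \<subseteq> {x \<in> topspace X. (f \<circ> q) x \<in> {2/3<..}}"
      using \<B>(3)[of "{x \<in> topspace X. (f \<circ> q) x \<in> {..<1/3}}" a] \<B>(3)[of "{x \<in> topspace X. (f \<circ> q) x \<in> {2/3<..}}" b]
        a b f(2,3) by auto
    have "P (A, B) f"
      using f(1) AB by (auto simp: P_def)
    then have I: "(A, B) \<in> I"
      using AB by (auto simp: I_def)
    \<comment> \<open>The chosen \<open>g (A, B)\<close> need not be \<open>f\<close>, but it obeys
      the same bounds on \<open>A\<close> and \<open>B\<close>, and these contain preimages of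
      \<open>y\<close> and \<open>z\<close>.\<close>
    have "g (A, B) y < 1/3" "g (A, B) z > 2/3"
      using g[OF I] AB a b by (auto simp: P_def)
    moreover have "g (A, B) y = g (A, B) z"
      using fun_cong[OF eq, of "(A, B)"] I by (simp add: h_def)
    ultimately show False by simp
  qed
  have "countable I"
    unfolding I_def by (rule countable_subset[of _ "\<B> \<times> \<B>"]) (use \<B>(1) in auto)
  then have Z: "metrizable_space ?Z"
    by (auto simp: metrizable_space_product_topology metrizable_space_euclidean)
  \<comment> \<open>A continuous bijection from a compact space onto a Hausdorff space is a
    homeomorphism.\<close>
  have "homeomorphic_map Y (subtopology ?Z (h ` topspace Y)) h"
  proof (rule continuous_imp_homeomorphic_map)
    show "continuous_map Y (subtopology ?Z (h ` topspace Y)) h"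
      using hc by (simp add: continuous_map_in_subtopology)
    show "Hausdorff_space (subtopology ?Z (h ` topspace Y))"
      using Z by (simp add: Hausdorff_space_subtopology metrizable_imp_Hausdorff_space)
    show "h ` topspace Y = topspace (subtopology ?Z (h ` topspace Y))"
      using continuous_map_image_subset_topspace[OF hc] by auto
  qed (use cY hinj in auto)
  then show ?thesis
    using Z by (meson homeomorphic_map_imp_homeomorphic_space homeomorphic_metrizable_space
        metrizable_space_subtopology)
qed

text \<open>The saturation of a closed set \<open>K\<close> is the second projection of the closed
  set \<open>E \<inter> K \<times> topspace X\<close>, and projection along a compact factor is a
  closed map. Closedness in the quotient is tested on preimages, which here are saturations.\<close>

lemma closed_map_quotient_space:
  assumes X: "compact_space X" and E: "equiv (topspace X) E" "closedin (prod_topology X X) E"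
  shows "closed_map X (quotient_space X E) (\<lambda>x. E `` {x})"
  unfolding closed_map_def
proof (intro allI impI)
  fix K assume K: "closedin X K"
  then have KX: "K \<subseteq> topspace X" by (rule closedin_subset)
  have "closedin (prod_topology X X) (E \<inter> K \<times> topspace X)"
    using E(2) K by (intro closedin_Int) (auto simp: closedin_prod_Times_iff)
  then have "closedin X (snd ` (E \<inter> K \<times> topspace X))"
    using closed_map_snd[OF X] by (auto simp: closed_map_def)
  also have "snd ` (E \<inter> K \<times> topspace X) = {x \<in> topspace X. E `` {x} \<in> (\<lambda>x. E `` {x}) ` K}"
  proof (intro set_eqI iffI)
    fix x assume "x \<in> snd ` (E \<inter> K \<times> topspace X)"
    then obtain k where "k \<in> K" "(k, x) \<in> E" "x \<in> topspace X" by auto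
    then show "x \<in> {x \<in> topspace X. E `` {x} \<in> (\<lambda>x. E `` {x}) ` K}"
      using equiv_class_eq[OF E(1)] by blast
  next
    fix x assume "x \<in> {x \<in> topspace X. E `` {x} \<in> (\<lambda>x. E `` {x}) ` K}"
    then obtain k where "k \<in> K" "x \<in> topspace X" "E `` {x} = E `` {k}" by auto
    then have "(k, x) \<in> E" using eq_equiv_class[of E k x "topspace X"] E(1) by auto
    with \<open>k \<in> K\<close> \<open>x \<in> topspace X\<close> show "x \<in> snd ` (E \<inter> K \<times> topspace X)" by force
  qed
  finally show "closedin (quotient_space X E) ((\<lambda>x. E `` {x}) ` K)"
    using quotient_map_quotient_space[of X E] image_mono[OF KX, of "\<lambda>x. E `` {x}"]
    unfolding quotient_map_closedin by simp
qed

text \<open>Compact Hausdorff spaces are normal, and normality passes along closed continuous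
  surjections. Points of the quotient are images of closed points, hence closed, and a normal T1
  space is Hausdorff.\<close>

lemma Hausdorff_space_quotient_space:
  assumes X: "compact_space X" "Hausdorff_space X"
    and E: "equiv (topspace X) E" "closedin (prod_topology X X) E"
  shows "Hausdorff_space (quotient_space X E)"
proof -
  let ?q = "\<lambda>x. E `` {x}"
  have cl: "closed_map X (quotient_space X E) ?q"
    by (rule closed_map_quotient_space[OF X(1) E])
  have q: "continuous_map X (quotient_space X E) ?q" "?q ` topspace X = topspace (quotient_space X E)"
    by (rule quotient_imp_continuous_map quotient_imp_surjective_map,
        rule quotient_map_quotient_space)+
  have "normal_space (quotient_space X E)"
    by (rule normal_space_continuous_closed_map_image[OF _ q(1) cl q(2)])
      (use X compact_Hausdorff_or_regular_imp_normal_space in blast)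
  moreover have "t1_space (quotient_space X E)"
    unfolding t1_space_closedin_singleton q(2)[symmetric]
  proof (intro ballI, elim imageE)
    fix y x assume "y = ?q x" "x \<in> topspace X"
    then show "closedin (quotient_space X E) {y}"
      using cl X(2) closedin_Hausdorff_singleton[of X x] unfolding closed_map_def
      by (metis image_empty image_insert)
  qed
  ultimately show ?thesis
    by (rule normal_t1_imp_Hausdorff_space)
qed

text \<open>As the two maps have the same fibres, each factors continuously through the other, and
  the two factors are mutually inverse.\<close>

lemma homeomorphic_space_quotient_maps:
  assumes f: "quotient_map X Y f" and g: "quotient_map X Z g"
    and fg: "\<And>x y. x \<in> topspace X \<Longrightarrow> y \<in> topspace X \<Longrightarrow> f x = f y \<longleftrightarrow> g x = g y"
  shows "Y homeomorphic_space Z"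
proof -
  obtain u where u: "continuous_map Y Z u" "\<And>x. x \<in> topspace X \<Longrightarrow> u (f x) = g x"
    using quotient_map_lift_exists[OF f quotient_imp_continuous_map[OF g]] fg by metis
  obtain v where v: "continuous_map Z Y v" "\<And>x. x \<in> topspace X \<Longrightarrow> v (g x) = f x"
    using quotient_map_lift_exists[OF g quotient_imp_continuous_map[OF f]] fg by metis
  have "homeomorphic_maps Y Z u v"
    unfolding homeomorphic_maps_def
    using u v quotient_imp_surjective_map[OF f] quotient_imp_surjective_map[OF g]
    by (metis (no_types, lifting) imageE)
  then show ?thesis
    unfolding homeomorphic_space_def by blast
qed

section \<open>Tuples\<close>

lemma map_tuple_map_tuple: "map_tuple n f (map_tuple n g a) = map_tuple n (f \<circ> g) a"
  by (auto simp: map_tuple_def)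

lemma map_tuple_cong:
  assumes "a \<in> {..<n} \<rightarrow>\<^sub>E S" "\<And>x. x \<in> S \<Longrightarrow> f x = g x"
  shows "map_tuple n f a = map_tuple n g a"
  using assms by (auto simp: map_tuple_def PiE_iff)

lemma map_tuple_ident:
  assumes "a \<in> {..<n} \<rightarrow>\<^sub>E S" "\<And>x. x \<in> S \<Longrightarrow> f x = x"
  shows "map_tuple n f a = a"
  using assms by (auto simp: map_tuple_def PiE_iff extensional_def)

lemma map_tuple_in_PiE:
  assumes "a \<in> {..<n} \<rightarrow>\<^sub>E S" "\<And>x. x \<in> S \<Longrightarrow> f x \<in> T"
  shows "map_tuple n f a \<in> {..<n} \<rightarrow>\<^sub>E T"
  using assms by (auto simp: map_tuple_def PiE_iff)

text \<open>Preimages can be chosen coordinate by coordinate. This serves to replace quantification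
  over tuples of codes by quantification over tuples of points.\<close>

lemma map_tuple_image_PiE: "map_tuple n f ` ({..<n} \<rightarrow>\<^sub>E S) = {..<n} \<rightarrow>\<^sub>E f ` S"
proof (intro equalityI subsetI)
  fix b assume b: "b \<in> {..<n} \<rightarrow>\<^sub>E f ` S"
  have "b = map_tuple n f (map_tuple n (inv_into S f) b)"
    unfolding map_tuple_map_tuple
    by (rule map_tuple_ident[OF b, symmetric]) (auto simp: f_inv_into_f)
  moreover have "map_tuple n (inv_into S f) b \<in> {..<n} \<rightarrow>\<^sub>E S"
    by (rule map_tuple_in_PiE[OF b]) (rule inv_into_into)
  ultimately show "b \<in> map_tuple n f ` ({..<n} \<rightarrow>\<^sub>E S)" by blast
next
  fix b assume "b \<in> map_tuple n f ` ({..<n} \<rightarrow>\<^sub>E S)"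
  then show "b \<in> {..<n} \<rightarrow>\<^sub>E f ` S"
    using map_tuple_in_PiE[of _ n S f "f ` S"] by blast
qed

lemma inj_on_map_tuple:
  assumes "inj_on f S"
  shows "inj_on (map_tuple n f) ({..<n} \<rightarrow>\<^sub>E S)"
proof (rule inj_on_inverseI)
  fix a assume "a \<in> {..<n} \<rightarrow>\<^sub>E S"
  then show "map_tuple n (inv_into S f) (map_tuple n f a) = a"
    unfolding map_tuple_map_tuple by (rule map_tuple_ident) (simp add: assms)
qed

lemma continuous_map_map_tuple:
  assumes "continuous_map X Y f"
  shows "continuous_map (power_topology n X) (power_topology n Y) (map_tuple n f)"
  unfolding continuous_map_componentwise
proof (intro conjI ballI)
  fix i assume i: "i \<in> {..<n}"
  have "continuous_map (power_topology n X) Y (f \<circ> (\<lambda>a. a i))"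
    by (rule continuous_map_compose[OF continuous_map_product_projection[OF i] assms])
  then show "continuous_map (power_topology n X) Y (\<lambda>a. map_tuple n f a i)"
    using i by (simp add: map_tuple_def o_def)
qed (auto simp: map_tuple_def)

section \<open>Epimorphisms\<close>

lemma epimorphism_in_carrier:
  "epimorphism L A B \<phi> \<Longrightarrow> x \<in> carrier_of A \<Longrightarrow> \<phi> x \<in> carrier_of B"
  by (auto simp: epimorphism_def)

lemma epimorphism_compose:
  assumes \<phi>: "epimorphism L A B \<phi>" and \<alpha>: "epimorphism L B C \<alpha>"
  shows "epimorphism L A C (\<alpha> \<circ> \<phi>)"
proof -
  have im: "\<phi> ` carrier_of A = carrier_of B"
    using \<phi> by (simp add: epimorphism_def)
  have "continuous_map (top_of A) (top_of C) (\<alpha> \<circ> \<phi>)"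
    using \<phi> \<alpha> by (intro continuous_map_compose[of _ "top_of B"]) (simp_all add: epimorphism_def)
  moreover have "(\<alpha> \<circ> \<phi>) ` carrier_of A = carrier_of C"
    using \<phi> \<alpha> unfolding epimorphism_def image_comp[symmetric] by simp
  moreover have "rel_of C r = map_tuple (rel_arity L r) (\<alpha> \<circ> \<phi>) ` rel_of A r" if "r \<in> rel_syms L" for r
    using \<phi> \<alpha> that by (simp add: epimorphism_def image_image map_tuple_map_tuple)
  moreover have "fun_of C f (map_tuple (fun_arity L f) (\<alpha> \<circ> \<phi>) a) = (\<alpha> \<circ> \<phi>) (fun_of A f a)"
    if f: "f \<in> fun_syms L" and a: "a \<in> {..<fun_arity L f} \<rightarrow>\<^sub>E carrier_of A" for f a
  proof -
    have "map_tuple (fun_arity L f) \<phi> a \<in> {..<fun_arity L f} \<rightarrow>\<^sub>E carrier_of B"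
      by (rule map_tuple_in_PiE[OF a]) (use im in auto)
    then show ?thesis
      using \<phi> \<alpha> f a by (simp add: epimorphism_def flip: map_tuple_map_tuple)
  qed
  ultimately show ?thesis
    using \<phi> \<alpha> by (simp add: epimorphism_def)
qed

text \<open>Continuity of the inverse comes from compactness and the Hausdorff property; relations
  are reflected because an epimorphism maps them exactly onto each other. Inverse automorphisms
  later turn an inclusion between relations into an equality.\<close>

lemma isomorphism_inv_into:
  assumes A: "topological_structure L A" and \<psi>: "isomorphism L A A \<psi>"
  shows "isomorphism L A A (inv_into (carrier_of A) \<psi>)"
proof -
  let ?g = "inv_into (carrier_of A) \<psi>"
  have e: "epimorphism L A A \<psi>" and bij: "bij_betw \<psi> (carrier_of A) (carrier_of A)"
    using \<psi> by (auto simp: isomorphism_def)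
  have inj: "inj_on \<psi> (carrier_of A)" and im: "\<psi> ` carrier_of A = carrier_of A"
    using bij by (auto simp: bij_betw_def)
  have "homeomorphic_map (top_of A) (top_of A) \<psi>"
    using A e inj im
    by (intro continuous_imp_homeomorphic_map) (auto simp: topological_structure_def epimorphism_def)
  then obtain g where g: "homeomorphic_maps (top_of A) (top_of A) \<psi> g"
    using homeomorphic_map_maps by blast
  \<comment> \<open>The inverse \<open>g\<close> supplied by the homeomorphism and \<open>?g\<close>
    need only agree on the carrier, which is all that continuity depends on.\<close>
  have "continuous_map (top_of A) (top_of A) ?g"
  proof (rule continuous_map_eq)
    show "continuous_map (top_of A) (top_of A) g"
      using g by (simp add: homeomorphic_maps_def)
    fix x assume "x \<in> carrier_of A"
    then obtain y where "y \<in> carrier_of A" "x = \<psi> y"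
      using im by blast
    then show "g x = ?g x"
      using g inj by (simp add: homeomorphic_maps_def)
  qed
  moreover have "rel_of A r = map_tuple (rel_arity L r) ?g ` rel_of A r" if r: "r \<in> rel_syms L" for r
  proof -
    let ?n = "rel_arity L r"
    \<comment> \<open>A closed set of tuples lies in the power space, so its members are extensional
      with entries in the carrier; on such tuples \<open>?g\<close> undoes
      \<open>\<psi>\<close>.\<close>
    have sub: "rel_of A r \<subseteq> {..<?n} \<rightarrow>\<^sub>E carrier_of A"
      using A r closedin_subset unfolding topological_structure_def by fastforce
    have "map_tuple ?n ?g ` rel_of A r = map_tuple ?n ?g ` map_tuple ?n \<psi> ` rel_of A r"
      using e r by (simp add: epimorphism_def)
    also have "\<dots> = (\<lambda>a. a) ` rel_of A r"
      unfolding image_image map_tuple_map_tuple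
      by (rule image_cong[OF refl], rule map_tuple_ident[of _ _ "carrier_of A"]) (use sub inj in auto)
    finally show ?thesis by simp
  qed
  moreover have "fun_of A f (map_tuple (fun_arity L f) ?g a) = ?g (fun_of A f a)"
    if f: "f \<in> fun_syms L" and a: "a \<in> {..<fun_arity L f} \<rightarrow>\<^sub>E carrier_of A" for f a
  proof -
    let ?n = "fun_arity L f"
    have ga: "map_tuple ?n ?g a \<in> {..<?n} \<rightarrow>\<^sub>E carrier_of A"
      by (rule map_tuple_in_PiE[OF a]) (metis im inv_into_into)
    have "map_tuple ?n \<psi> (map_tuple ?n ?g a) = a"
      unfolding map_tuple_map_tuple
      by (rule map_tuple_ident[OF a]) (simp add: f_inv_into_f im)
    then have "fun_of A f a = \<psi> (fun_of A f (map_tuple ?n ?g a))"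
      using e f ga unfolding epimorphism_def topspace_product_topology by metis
    moreover have "fun_of A f (map_tuple ?n ?g a) \<in> carrier_of A"
      using A f ga unfolding topological_structure_def continuous_map_def by auto
    ultimately show ?thesis
      using inj by simp
  qed
  moreover have "?g (const_of A c) = const_of A c" if "c \<in> const_syms L" for c
  proof -
    have "\<psi> (const_of A c) = const_of A c" "const_of A c \<in> carrier_of A"
      using A e that by (auto simp: topological_structure_def epimorphism_def)
    then show ?thesis
      using inv_into_f_f[OF inj] by metis
  qed
  ultimately show ?thesis
    using bij_betw_inv_into[OF bij] by (auto simp: isomorphism_def epimorphism_def bij_betw_def)
qed

lemma projective_Fraisse_limit_homogeneous:
  assumes "projective_Fraisse_limit L \<F> \<FF>" "D \<in> \<F>"
    "epimorphism L \<FF> D \<phi>\<^sub>1" "epimorphism L \<FF> D \<phi>\<^sub>2"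
  obtains \<psi> where "isomorphism L \<FF> \<FF> \<psi>" "\<And>x. x \<in> carrier_of \<FF> \<Longrightarrow> \<phi>\<^sub>2 x = \<phi>\<^sub>1 (\<psi> x)"
proof -
  have "\<exists>\<psi>. isomorphism L \<FF> \<FF> \<psi> \<and> (\<forall>x\<in>carrier_of \<FF>. \<phi>\<^sub>2 x = \<phi>\<^sub>1 (\<psi> x))"
    using assms unfolding projective_Fraisse_limit_def by simp
  then show thesis
    using that by blast
qed

section \<open>Recoding structures by natural numbers and sequences of bits\<close>

text \<open>The bit sequences only serve as names of points: the topology is transported along an
  injection, which need not be continuous for the product topology.\<close>

definition copy_topology :: "('a \<Rightarrow> 'b) \<Rightarrow> 'a topology \<Rightarrow> 'b topology" where
  "copy_topology h X = pullback_topology (h ` topspace X) (inv_into (topspace X) h) X"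

lemma topspace_copy_topology [simp]: "topspace (copy_topology h X) = h ` topspace X"
  by (auto simp: copy_topology_def topspace_pullback_topology inv_into_into)

lemma homeomorphic_maps_copy_topology:
  assumes "inj_on h (topspace X)"
  shows "homeomorphic_maps X (copy_topology h X) h (inv_into (topspace X) h)"
  unfolding homeomorphic_maps_def
proof (intro conjI)
  let ?g = "inv_into (topspace X) h"
  show "continuous_map X (copy_topology h X) h"
    unfolding copy_topology_def
  proof (rule continuous_map_pullback')
    show "continuous_map X X (?g \<circ> h)"
      by (rule continuous_map_eq[OF continuous_map_id]) (simp add: assms)
  qed auto
  show "continuous_map (copy_topology h X) X ?g"
    unfolding copy_topology_def using continuous_map_pullback[OF continuous_map_id[of X]] by simp
qed (auto simp: assms f_inv_into_f)

text \<open>Symbols are numbered by \<open>to_nat_on\<close>, which is injective on the finite sets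
  of symbols occurring here. Arities are read back through \<open>from_nat_into\<close>, so they are
  significant only at numbers that name symbols.\<close>

definition recode_language :: "('r, 'f, 'c) language \<Rightarrow> (nat, nat, nat) language" where
  "recode_language L =
     \<lparr>rel_syms = to_nat_on (rel_syms L) ` rel_syms L,
      rel_arity = (\<lambda>m. rel_arity L (from_nat_into (rel_syms L) m)),
      fun_syms = to_nat_on (fun_syms L) ` fun_syms L,
      fun_arity = (\<lambda>m. fun_arity L (from_nat_into (fun_syms L) m)),
      const_syms = to_nat_on (const_syms L) ` const_syms L\<rparr>"

definition recode ::
    "('r, 'f, 'c) language \<Rightarrow> ('a \<Rightarrow> 'b) \<Rightarrow> ('r, 'f, 'c, 'a) struct \<Rightarrow> (nat, nat, nat, 'b) struct" where
  "recode L h A =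
     \<lparr>top_of = copy_topology h (top_of A),
      rel_of = (\<lambda>m. let r = from_nat_into (rel_syms L) m in map_tuple (rel_arity L r) h ` rel_of A r),
      fun_of = (\<lambda>m b. let f = from_nat_into (fun_syms L) m in
        h (fun_of A f (map_tuple (fun_arity L f) (inv_into (carrier_of A) h) b))),
      const_of = (\<lambda>m. h (const_of A (from_nat_into (const_syms L) m)))\<rparr>"

lemma top_of_recode [simp]: "top_of (recode L h A) = copy_topology h (top_of A)"
  by (simp add: recode_def)

lemma finite_language_recode: "finite_language L \<Longrightarrow> finite_language (recode_language L)"
  by (simp add: finite_language_def recode_language_def)

context
  fixes L :: "('r, 'f, 'c) language"
  assumes L: "finite_language L"
begin

lemma from_nat_into_syms [simp]:
  "r \<in> rel_syms L \<Longrightarrow> from_nat_into (rel_syms L) (to_nat_on (rel_syms L) r) = r"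
  "f \<in> fun_syms L \<Longrightarrow> from_nat_into (fun_syms L) (to_nat_on (fun_syms L) f) = f"
  "c \<in> const_syms L \<Longrightarrow> from_nat_into (const_syms L) (to_nat_on (const_syms L) c) = c"
  using L by (simp_all add: finite_language_def countable_finite)

lemma topological_structure_recode:
  assumes A: "topological_structure L A" and h: "inj_on h (carrier_of A)"
  shows "topological_structure (recode_language L) (recode L h A)"
proof -
  let ?g = "inv_into (carrier_of A) h"
  have hg: "homeomorphic_maps (top_of A) (copy_topology h (top_of A)) h ?g"
    by (rule homeomorphic_maps_copy_topology[OF h])
  then have hom: "top_of A homeomorphic_space copy_topology h (top_of A)"
    unfolding homeomorphic_space_def by blast
  have hc: "continuous_map (top_of A) (copy_topology h (top_of A)) h"
    and gc: "continuous_map (copy_topology h (top_of A)) (top_of A) ?g"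
    using hg by (auto simp: homeomorphic_maps_def)
  \<comment> \<open>The tuplewise image of \<open>S\<close> under \<open>h\<close> is its preimage
    under the continuous decoding map, hence closed.\<close>
  have "closedin (power_topology n (copy_topology h (top_of A))) (map_tuple n h ` S)"
    if S: "closedin (power_topology n (top_of A)) S" for n S
  proof -
    have SA: "S \<subseteq> {..<n} \<rightarrow>\<^sub>E carrier_of A"
      using closedin_subset[OF S] by simp
    have "closedin (power_topology n (copy_topology h (top_of A)))
       {a \<in> topspace (power_topology n (copy_topology h (top_of A))). map_tuple n ?g a \<in> S}"
      by (rule closedin_continuous_map_preimage[OF continuous_map_map_tuple[OF gc] S])
    also have "{a \<in> topspace (power_topology n (copy_topology h (top_of A))). map_tuple n ?g a \<in> S}
        = map_tuple n h ` S"
    proof (intro set_eqI iffI)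
      fix b assume "b \<in> {a \<in> topspace (power_topology n (copy_topology h (top_of A))). map_tuple n ?g a \<in> S}"
      then have b: "b \<in> {..<n} \<rightarrow>\<^sub>E h ` carrier_of A" "map_tuple n ?g b \<in> S" by auto
      have "map_tuple n h (map_tuple n ?g b) = b"
        unfolding map_tuple_map_tuple by (rule map_tuple_ident[OF b(1)]) (simp add: f_inv_into_f)
      with b(2) show "b \<in> map_tuple n h ` S" by (metis imageI)
    next
      fix b assume "b \<in> map_tuple n h ` S"
      then obtain a where a: "a \<in> S" "b = map_tuple n h a" by blast
      then have a': "a \<in> {..<n} \<rightarrow>\<^sub>E carrier_of A" using SA by blast
      have "map_tuple n ?g b = a"
        unfolding a(2) map_tuple_map_tuple by (rule map_tuple_ident[OF a']) (simp add: h)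
      moreover have "b \<in> {..<n} \<rightarrow>\<^sub>E h ` carrier_of A"
        unfolding a(2) by (rule map_tuple_in_PiE[OF a']) simp
      ultimately show "b \<in> {a \<in> topspace (power_topology n (copy_topology h (top_of A))). map_tuple n ?g a \<in> S}"
        using a(1) by simp
    qed
    finally show ?thesis .
  qed
  moreover have "continuous_map (power_topology n (copy_topology h (top_of A))) (copy_topology h (top_of A))
      (\<lambda>b. h (u (map_tuple n ?g b)))"
    if u: "continuous_map (power_topology n (top_of A)) (top_of A) u" for n u
    using continuous_map_compose[OF continuous_map_map_tuple[OF gc]
        continuous_map_compose[OF u hc]] by (simp add: o_def)
  ultimately show ?thesis
    using A homeomorphic_space_dimension_le[OF hom] homeomorphic_compact_space[OF hom]
      homeomorphic_Hausdorff_space[OF hom] homeomorphic_space_second_countability[OF hom]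
    by (auto simp: topological_structure_def recode_def recode_language_def)
qed

text \<open>Injectivity of \<open>k\<close> on the carrier of \<open>B\<close> lets every clause be
  cancelled down to the original structures. The map \<open>\<phi>'\<close> is prescribed only on
  codes, so one statement serves both to encode a given \<open>\<phi>\<close> and to decode a given
  \<open>\<phi>'\<close>.\<close>

lemma epimorphism_recode_iff:
  assumes A: "topological_structure L A" and h: "inj_on h (carrier_of A)"
    and B: "topological_structure L B" and k: "inj_on k (carrier_of B)"
    and \<phi>: "\<And>x. x \<in> carrier_of A \<Longrightarrow> \<phi> x \<in> carrier_of B"
    and \<phi>': "\<And>x. x \<in> carrier_of A \<Longrightarrow> \<phi>' (h x) = k (\<phi> x)"
  shows "epimorphism (recode_language L) (recode L h A) (recode L k B) \<phi>' \<longleftrightarrow> epimorphism L A B \<phi>"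
proof -
  let ?X = "top_of A" and ?Y = "top_of B"
  let ?gh = "inv_into (carrier_of A) h" and ?gk = "inv_into (carrier_of B) k"
  have hc: "continuous_map ?X (copy_topology h ?X) h" "continuous_map (copy_topology h ?X) ?X ?gh"
    using homeomorphic_maps_copy_topology[OF h] by (auto simp: homeomorphic_maps_def)
  have kc: "continuous_map ?Y (copy_topology k ?Y) k" "continuous_map (copy_topology k ?Y) ?Y ?gk"
    using homeomorphic_maps_copy_topology[OF k] by (auto simp: homeomorphic_maps_def)
  have cont: "continuous_map (copy_topology h ?X) (copy_topology k ?Y) \<phi>' \<longleftrightarrow> continuous_map ?X ?Y \<phi>"
  proof
    assume "continuous_map (copy_topology h ?X) (copy_topology k ?Y) \<phi>'"
    then have "continuous_map ?X ?Y (?gk \<circ> (\<phi>' \<circ> h))"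
      using hc kc by (blast intro: continuous_map_compose)
    then show "continuous_map ?X ?Y \<phi>"
      by (rule continuous_map_eq) (simp add: \<phi>' \<phi> k)
  next
    assume "continuous_map ?X ?Y \<phi>"
    then have "continuous_map (copy_topology h ?X) (copy_topology k ?Y) (k \<circ> (\<phi> \<circ> ?gh))"
      using hc kc by (blast intro: continuous_map_compose)
    then show "continuous_map (copy_topology h ?X) (copy_topology k ?Y) \<phi>'"
      by (rule continuous_map_eq) (auto simp: \<phi>' h)
  qed
  have "\<phi>' ` h ` carrier_of A = k ` \<phi> ` carrier_of A"
    using \<phi>' by (auto simp: image_image)
  moreover have "k ` \<phi> ` carrier_of A = k ` carrier_of B \<longleftrightarrow> \<phi> ` carrier_of A = carrier_of B"
    using \<phi> by (intro inj_on_image_eq_iff[OF k]) auto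
  ultimately have surj: "\<phi>' ` h ` carrier_of A = k ` carrier_of B \<longleftrightarrow> \<phi> ` carrier_of A = carrier_of B"
    by simp
  have tup: "map_tuple n \<phi>' (map_tuple n h a) = map_tuple n k (map_tuple n \<phi> a)"
    if "a \<in> {..<n} \<rightarrow>\<^sub>E carrier_of A" for n a
    unfolding map_tuple_map_tuple by (rule map_tuple_cong[OF that]) (simp add: \<phi>')
  have rel: "map_tuple n k ` T = map_tuple n \<phi>' ` map_tuple n h ` S \<longleftrightarrow> T = map_tuple n \<phi> ` S"
    if S: "closedin (power_topology n ?X) S" and T: "closedin (power_topology n ?Y) T" for n S T
  proof -
    have SA: "S \<subseteq> {..<n} \<rightarrow>\<^sub>E carrier_of A" and TB: "T \<subseteq> {..<n} \<rightarrow>\<^sub>E carrier_of B"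
      using closedin_subset[OF S] closedin_subset[OF T] by simp_all
    have "map_tuple n \<phi>' ` map_tuple n h ` S = map_tuple n k ` map_tuple n \<phi> ` S"
      unfolding image_image using SA tup by (intro image_cong) auto
    moreover have "map_tuple n \<phi> ` S \<subseteq> {..<n} \<rightarrow>\<^sub>E carrier_of B"
      using map_tuple_in_PiE[where f = \<phi>, OF subsetD[OF SA] \<phi>] by blast
    ultimately show ?thesis
      using inj_on_image_eq_iff[OF inj_on_map_tuple[OF k] TB] by metis
  qed
  have "func": "(\<forall>b\<in>{..<n} \<rightarrow>\<^sub>E h ` carrier_of A. k (v (map_tuple n ?gk (map_tuple n \<phi>' b)))
        = \<phi>' (h (u (map_tuple n ?gh b)))) \<longleftrightarrow>
      (\<forall>a\<in>{..<n} \<rightarrow>\<^sub>E carrier_of A. v (map_tuple n \<phi> a) = \<phi> (u a))"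
    if u: "continuous_map (power_topology n ?X) ?X u" and v: "continuous_map (power_topology n ?Y) ?Y v"
    for n u v
    \<comment> \<open>Every tuple of codes encodes a tuple of points, so the quantifier moves to
      tuples from the carrier of \<open>A\<close>.\<close>
    unfolding map_tuple_image_PiE[symmetric] ball_simps
  proof (rule ball_cong[OF refl])
    fix a assume a: "a \<in> {..<n} \<rightarrow>\<^sub>E carrier_of A"
    have \<phi>a: "map_tuple n \<phi> a \<in> {..<n} \<rightarrow>\<^sub>E carrier_of B"
      by (rule map_tuple_in_PiE[OF a \<phi>])
    have ua: "u a \<in> carrier_of A" and va: "v (map_tuple n \<phi> a) \<in> carrier_of B"
      using u v a \<phi>a by (auto simp: continuous_map_def)
    have "map_tuple n ?gk (map_tuple n \<phi>' (map_tuple n h a)) = map_tuple n \<phi> a"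
      unfolding tup[OF a] unfolding map_tuple_map_tuple[of n ?gk]
      by (rule map_tuple_ident[OF \<phi>a]) (simp add: k)
    moreover have "map_tuple n ?gh (map_tuple n h a) = a"
      unfolding map_tuple_map_tuple by (rule map_tuple_ident[OF a]) (simp add: h)
    ultimately show "k (v (map_tuple n ?gk (map_tuple n \<phi>' (map_tuple n h a))))
        = \<phi>' (h (u (map_tuple n ?gh (map_tuple n h a)))) \<longleftrightarrow> v (map_tuple n \<phi> a) = \<phi> (u a)"
      using \<phi>'[OF ua] \<phi>[OF ua] va inj_on_eq_iff[OF k] by auto
  qed
  have const: "\<phi>' (h c) = k e \<longleftrightarrow> \<phi> c = e" if "c \<in> carrier_of A" "e \<in> carrier_of B" for c e
    using that \<phi>' \<phi> inj_on_eq_iff[OF k] by auto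
  show ?thesis
    using A B unfolding topological_structure_def epimorphism_def
    by (simp add: recode_def recode_language_def cont surj rel "func" const cong: ball_cong)
qed

lemma epimorphism_recode:
  assumes A: "topological_structure L A" and h: "inj_on h (carrier_of A)"
    and B: "topological_structure L B" and k: "inj_on k (carrier_of B)"
    and \<phi>: "epimorphism L A B \<phi>"
  shows "epimorphism (recode_language L) (recode L h A) (recode L k B)
    (\<lambda>y. k (\<phi> (inv_into (carrier_of A) h y)))"
  using \<phi> h by (subst epimorphism_recode_iff[OF A h B k, of \<phi>]) (auto simp: epimorphism_def)

lemma epimorphism_of_recode:
  assumes A: "topological_structure L A" and h: "inj_on h (carrier_of A)"
    and B: "topological_structure L B" and k: "inj_on k (carrier_of B)"
    and \<phi>: "epimorphism (recode_language L) (recode L h A) (recode L k B) \<phi>"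
  shows "epimorphism L A B (\<lambda>x. inv_into (carrier_of B) k (\<phi> (h x)))"
proof -
  \<comment> \<open>The values of \<open>\<phi>\<close> are codes of points of \<open>B\<close>;
    only there does \<open>inv_into\<close> really decode.\<close>
  have "\<phi> (h x) \<in> k ` carrier_of B" if "x \<in> carrier_of A" for x
    using \<phi> that by (auto simp: epimorphism_def)
  then show ?thesis
    using \<phi> by (subst epimorphism_recode_iff[OF A h B k, of _ \<phi>, symmetric])
      (auto simp: f_inv_into_f inv_into_into)
qed

lemma isomorphism_recode:
  assumes A: "topological_structure L A" and h: "inj_on h (carrier_of A)"
    and \<psi>: "isomorphism L A A \<psi>"
  shows "isomorphism (recode_language L) (recode L h A) (recode L h A)
    (\<lambda>y. h (\<psi> (inv_into (carrier_of A) h y)))"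
proof -
  have "bij_betw (h \<circ> (\<psi> \<circ> inv_into (carrier_of A) h)) (h ` carrier_of A) (h ` carrier_of A)"
    using \<psi> inj_on_imp_bij_betw[OF h] bij_betw_inv_into[OF inj_on_imp_bij_betw[OF h]]
    unfolding isomorphism_def by (blast intro: bij_betw_trans)
  then show ?thesis
    using epimorphism_recode[OF A h A h] \<psi> by (simp add: isomorphism_def o_def)
qed

text \<open>Given maps are decoded, the property of \<open>\<F>\<close> is applied, and the
  resulting maps are encoded again. Each member has its own coding \<open>k D\<close>, since the
  carriers are numbered independently.\<close>

lemma projective_Fraisse_family_recode:
  assumes \<F>: "projective_Fraisse_family L \<F>"
    and k: "\<And>D. D \<in> \<F> \<Longrightarrow> inj_on (k D) (carrier_of D)"
  shows "projective_Fraisse_family (recode_language L) ((\<lambda>D. recode L (k D) D) ` \<F>)"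
proof -
  have ts: "topological_structure L D" if "D \<in> \<F>" for D
    using \<F> that by (simp add: projective_Fraisse_family_def)
  note fwd = epimorphism_recode[OF ts k ts k] and bwd = epimorphism_of_recode[OF ts k ts k]
  have JPP: "\<exists>F\<in>\<F>. (\<exists>\<phi>. epimorphism L F D \<phi>) \<and> (\<exists>\<psi>. epimorphism L F E \<psi>)"
    if "D \<in> \<F>" "E \<in> \<F>" for D E
    using \<F> that by (simp add: projective_Fraisse_family_def)
  have AP: "\<exists>F\<in>\<F>. \<exists>\<psi>\<^sub>1 \<psi>\<^sub>2. epimorphism L F D \<psi>\<^sub>1 \<and> epimorphism L F E \<psi>\<^sub>2 \<and>
      (\<forall>x\<in>carrier_of F. \<phi>\<^sub>1 (\<psi>\<^sub>1 x) = \<phi>\<^sub>2 (\<psi>\<^sub>2 x))"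
    if "C \<in> \<F>" "D \<in> \<F>" "E \<in> \<F>" "epimorphism L D C \<phi>\<^sub>1" "epimorphism L E C \<phi>\<^sub>2" for C D E \<phi>\<^sub>1 \<phi>\<^sub>2
    using \<F> that by (simp add: projective_Fraisse_family_def)
  have ap: "\<exists>F\<in>\<F>. \<exists>\<psi>\<^sub>1 \<psi>\<^sub>2.
      epimorphism (recode_language L) (recode L (k F) F) (recode L (k D) D) \<psi>\<^sub>1 \<and>
      epimorphism (recode_language L) (recode L (k F) F) (recode L (k E) E) \<psi>\<^sub>2 \<and>
      (\<forall>x\<in>k F ` carrier_of F. \<phi>\<^sub>1 (\<psi>\<^sub>1 x) = \<phi>\<^sub>2 (\<psi>\<^sub>2 x))"
    if CDE: "C \<in> \<F>" "D \<in> \<F>" "E \<in> \<F>"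
      and \<phi>: "epimorphism (recode_language L) (recode L (k D) D) (recode L (k C) C) \<phi>\<^sub>1"
        "epimorphism (recode_language L) (recode L (k E) E) (recode L (k C) C) \<phi>\<^sub>2"
    for C D E \<phi>\<^sub>1 \<phi>\<^sub>2
  proof -
    let ?g = "inv_into (carrier_of C) (k C)"
    have e: "epimorphism L D C (\<lambda>x. ?g (\<phi>\<^sub>1 (k D x)))" "epimorphism L E C (\<lambda>x. ?g (\<phi>\<^sub>2 (k E x)))"
      by (rule bwd, (rule CDE \<phi>)+)+
    obtain F \<psi>\<^sub>1 \<psi>\<^sub>2 where F: "F \<in> \<F>" and \<psi>: "epimorphism L F D \<psi>\<^sub>1" "epimorphism L F E \<psi>\<^sub>2"
      and eq: "\<And>x. x \<in> carrier_of F \<Longrightarrow> ?g (\<phi>\<^sub>1 (k D (\<psi>\<^sub>1 x))) = ?g (\<phi>\<^sub>2 (k E (\<psi>\<^sub>2 x)))"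
      using AP[OF CDE e] by blast
    \<comment> \<open>Amalgamation yields an equality of decoded values. Both values are codes from
      \<open>C\<close>, on which decoding is injective, so the equality holds before decoding as
      well.\<close>
    have eq': "\<phi>\<^sub>1 (k D (\<psi>\<^sub>1 x)) = \<phi>\<^sub>2 (k E (\<psi>\<^sub>2 x))" if x: "x \<in> carrier_of F" for x
    proof -
      have "\<phi>\<^sub>1 (k D (\<psi>\<^sub>1 x)) \<in> k C ` carrier_of C" "\<phi>\<^sub>2 (k E (\<psi>\<^sub>2 x)) \<in> k C ` carrier_of C"
        using epimorphism_in_carrier[OF \<phi>(1)] epimorphism_in_carrier[OF \<phi>(2)]
          epimorphism_in_carrier[OF \<psi>(1) x] epimorphism_in_carrier[OF \<psi>(2) x] by auto
      then show ?thesis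
        using eq[OF x] by (metis f_inv_into_f)
    qed
    let ?h = "inv_into (carrier_of F) (k F)"
    have "\<forall>x\<in>k F ` carrier_of F. \<phi>\<^sub>1 (k D (\<psi>\<^sub>1 (?h x))) = \<phi>\<^sub>2 (k E (\<psi>\<^sub>2 (?h x)))"
      using eq' inv_into_into by metis
    then show ?thesis
      using F fwd[OF F F CDE(2) CDE(2) \<psi>(1)] fwd[OF F F CDE(3) CDE(3) \<psi>(2)] by blast
  qed
  have jpp: "\<exists>F\<in>\<F>. (\<exists>\<phi>. epimorphism (recode_language L) (recode L (k F) F) (recode L (k D) D) \<phi>) \<and>
      (\<exists>\<psi>. epimorphism (recode_language L) (recode L (k F) F) (recode L (k E) E) \<psi>)"
    if DE: "D \<in> \<F>" "E \<in> \<F>" for D E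
  proof -
    obtain F \<phi> \<psi> where F: "F \<in> \<F>" "epimorphism L F D \<phi>" "epimorphism L F E \<psi>"
      using JPP[OF DE] by blast
    then show ?thesis
      using fwd[OF F(1,1) DE(1,1) F(2)] fwd[OF F(1,1) DE(2,2) F(3)] by blast
  qed
  show ?thesis
    \<comment> \<open>Quantifiers over the image family become quantifiers over \<open>\<F>\<close>
      itself, so it does no harm if two members receive the same recoded structure.\<close>
    unfolding projective_Fraisse_family_def ball_simps(9) bex_simps(7)
    unfolding top_of_recode topspace_copy_topology
    by (intro conjI ballI allI impI; (elim conjE)?;
        rule topological_structure_recode[OF ts k] jpp ap; assumption)
qed

text \<open>The limit conditions transfer by the same decoding and encoding of maps; for (L2) the
  map to a finite set is pulled back along the homeomorphism \<open>h\<close>, and the factor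
  \<open>f'\<close> is precomposed with the decoding of \<open>D\<close>.\<close>

lemma projective_Fraisse_limit_recode:
  assumes \<F>: "projective_Fraisse_family L \<F>" and lim: "projective_Fraisse_limit L \<F> \<FF>"
    and k: "\<And>D. D \<in> \<F> \<Longrightarrow> inj_on (k D) (carrier_of D)" and h: "inj_on h (carrier_of \<FF>)"
  shows "projective_Fraisse_limit (recode_language L) ((\<lambda>D. recode L (k D) D) ` \<F>) (recode L h \<FF>)"
proof -
  have ts: "topological_structure L D" if "D \<in> \<F>" for D
    using \<F> that by (simp add: projective_Fraisse_family_def)
  have tF: "topological_structure L \<FF>"
    using lim by (simp add: projective_Fraisse_limit_def)
  let ?g = "inv_into (carrier_of \<FF>) h"
  note fwd = epimorphism_recode[OF tF h ts k] and bwd = epimorphism_of_recode[OF tF h ts k]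
  have hc: "continuous_map (top_of \<FF>) (copy_topology h (top_of \<FF>)) h"
    using homeomorphic_maps_copy_topology[OF h] by (auto simp: homeomorphic_maps_def)
  have L1: "\<exists>\<phi>. epimorphism (recode_language L) (recode L h \<FF>) (recode L (k D) D) \<phi>" if "D \<in> \<F>" for D
  proof -
    obtain \<phi> where "epimorphism L \<FF> D \<phi>"
      using lim \<open>D \<in> \<F>\<close> by (auto simp: projective_Fraisse_limit_def)
    then show ?thesis
      using fwd[OF that that] by blast
  qed
  have L2: "\<exists>D\<in>\<F>. \<exists>\<phi> f'. epimorphism (recode_language L) (recode L h \<FF>) (recode L (k D) D) \<phi> \<and>
      f' \<in> k D ` carrier_of D \<rightarrow> A \<and> (\<forall>x\<in>h ` carrier_of \<FF>. f x = f' (\<phi> x))"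
    if A: "finite A" and f: "continuous_map (copy_topology h (top_of \<FF>)) (discrete_topology A) f"
    for A :: "nat set" and f
  proof -
    have "continuous_map (top_of \<FF>) (discrete_topology A) (f \<circ> h)"
      by (rule continuous_map_compose[OF hc f])
    then obtain D \<phi> f' where D: "D \<in> \<F>" "epimorphism L \<FF> D \<phi>" "f' \<in> carrier_of D \<rightarrow> A"
        "\<And>x. x \<in> carrier_of \<FF> \<Longrightarrow> f (h x) = f' (\<phi> x)"
      using lim A unfolding projective_Fraisse_limit_def o_def by metis
    have \<phi>D: "\<phi> x \<in> carrier_of D" if "x \<in> carrier_of \<FF>" for x
      using D(2) that by (auto simp: epimorphism_def)
    let ?f = "\<lambda>y. f' (inv_into (carrier_of D) (k D) y)"
    have "?f \<in> k D ` carrier_of D \<rightarrow> A"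
      using D(3) k[OF D(1)] by auto
    moreover have "\<forall>x\<in>h ` carrier_of \<FF>. f x = ?f (k D (\<phi> (?g x)))"
      using D(4) \<phi>D k[OF D(1)] h by auto
    ultimately show ?thesis
      using D(1) fwd[OF D(1) D(1,2)]
      by (intro bexI[of _ D] exI[of _ "\<lambda>y. k D (\<phi> (?g y))"] exI[of _ ?f]) auto
  qed
  have L3: "\<exists>\<psi>. isomorphism (recode_language L) (recode L h \<FF>) (recode L h \<FF>) \<psi> \<and>
      (\<forall>x\<in>h ` carrier_of \<FF>. \<phi>\<^sub>2 x = \<phi>\<^sub>1 (\<psi> x))"
    if D: "D \<in> \<F>" and \<phi>: "epimorphism (recode_language L) (recode L h \<FF>) (recode L (k D) D) \<phi>\<^sub>1"
      "epimorphism (recode_language L) (recode L h \<FF>) (recode L (k D) D) \<phi>\<^sub>2" for D \<phi>\<^sub>1 \<phi>\<^sub>2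
  proof -
    let ?k = "inv_into (carrier_of D) (k D)"
    have e: "epimorphism L \<FF> D (\<lambda>x. ?k (\<phi>\<^sub>1 (h x)))" "epimorphism L \<FF> D (\<lambda>x. ?k (\<phi>\<^sub>2 (h x)))"
      by (rule bwd, (rule D \<phi>)+)+
    obtain \<psi> where \<psi>: "isomorphism L \<FF> \<FF> \<psi>"
        "\<And>x. x \<in> carrier_of \<FF> \<Longrightarrow> ?k (\<phi>\<^sub>2 (h x)) = ?k (\<phi>\<^sub>1 (h (\<psi> x)))"
      using projective_Fraisse_limit_homogeneous[OF lim D e] by blast
    \<comment> \<open>Decoding is injective on the codes of \<open>D\<close>, so the equation that
      (L3) gives for decoded values lifts to the codes.\<close>
    have "\<phi>\<^sub>2 (h x) = \<phi>\<^sub>1 (h (\<psi> x))" if x: "x \<in> carrier_of \<FF>" for x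
    proof -
      have "\<phi>\<^sub>2 (h x) \<in> k D ` carrier_of D" "\<phi>\<^sub>1 (h (\<psi> x)) \<in> k D ` carrier_of D"
        using epimorphism_in_carrier[OF \<phi>(1)] epimorphism_in_carrier[OF \<phi>(2)] x
          epimorphism_in_carrier[of L \<FF> \<FF> \<psi> x] \<psi>(1) by (auto simp: isomorphism_def)
      then show ?thesis
        using \<psi>(2)[OF x] by (metis f_inv_into_f)
    qed
    then have "\<forall>x\<in>h ` carrier_of \<FF>. \<phi>\<^sub>2 x = \<phi>\<^sub>1 (h (\<psi> (?g x)))"
      by (simp add: h)
    then show ?thesis
      using isomorphism_recode[OF tF h \<psi>(1)] by blast
  qed
  show ?thesis
    unfolding projective_Fraisse_limit_def ball_simps(9) bex_simps(7)
    unfolding top_of_recode topspace_copy_topology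
    by (intro conjI ballI allI impI topological_structure_recode[OF tF h]; (elim conjE)?;
        rule L1 L2 L3; assumption)
qed

end

section \<open>Finite representability over arbitrary types of symbols and points\<close>

lemma binary_rel_of_recode:
  assumes "finite_language L" "binary_rel_symbol L R"
  shows "binary_rel_of (recode L h A) (to_nat_on (rel_syms L) R) = map_prod h h ` binary_rel_of A R"
  using assms unfolding binary_rel_of_def
  by (auto simp: recode_def binary_rel_symbol_def image_image map_tuple_def)

text \<open>A point is recorded by the members of a countable base that contain it; an open set
  separating two points contains a basic set that tells them apart.\<close>

lemma second_countable_Hausdorff_inj_bits:
  assumes "second_countable X" "Hausdorff_space X"
  obtains h :: "'a \<Rightarrow> nat \<Rightarrow> bool" where "inj_on h (topspace X)"
proof -
  obtain \<B> where \<B>: "countable \<B>" "\<And>U x. openin X U \<Longrightarrow> x \<in> U \<Longrightarrow> \<exists>V\<in>\<B>. x \<in> V \<and> V \<subseteq> U"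
    using assms(1) unfolding second_countable_def by metis
  have "inj_on (\<lambda>x n. x \<in> from_nat_into \<B> n) (topspace X)"
  proof (rule inj_onI, rule ccontr)
    fix x y assume xy: "x \<in> topspace X" "y \<in> topspace X" "x \<noteq> y"
      and eq: "(\<lambda>n. x \<in> from_nat_into \<B> n) = (\<lambda>n. y \<in> from_nat_into \<B> n)"
    then obtain U where "openin X U" "x \<in> U" "y \<notin> U"
      using assms(2) unfolding Hausdorff_space_def disjnt_def by (metis IntI empty_iff)
    then obtain V where V: "V \<in> \<B>" "x \<in> V" "y \<notin> V"
      using \<B>(2) by blast
    show False
      using fun_cong[OF eq, of "to_nat_on \<B> V"] V \<B>(1) by simp
  qed
  then show thesis by (rule that)
qed

text \<open>The definition of finite representability fixes the types of symbols and of points.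
  Recoding removes this restriction: symbols and finite carriers are numbered, and the points of the
  limit are named by bit sequences.\<close>

lemma finitely_representableI:
  fixes \<F> :: "('r, 'f, 'c, 'd) struct set" and \<FF> :: "('r, 'f, 'c, 'a) struct" and Y :: "'y topology"
  assumes L: "finite_language L" "binary_rel_symbol L R"
    and Y: "compact_space Y" "metrizable_space Y"
    and cnt: "countable \<F>" and fin: "\<And>D. D \<in> \<F> \<Longrightarrow> finite (carrier_of D)"
    and \<F>: "projective_Fraisse_family L \<F>" and lim: "projective_Fraisse_limit L \<F> \<FF>"
    and eqv: "equiv (carrier_of \<FF>) (binary_rel_of \<FF> R)"
    and hom: "quotient_space (top_of \<FF>) (binary_rel_of \<FF> R) homeomorphic_space Y"
  shows "finitely_representable Y"
proof -
  let ?X = "top_of \<FF>" and ?E = "binary_rel_of \<FF> R"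
  have "second_countable ?X" "Hausdorff_space ?X"
    using lim by (auto simp: projective_Fraisse_limit_def topological_structure_def)
  then obtain h :: "'a \<Rightarrow> nat \<Rightarrow> bool" where h: "inj_on h (carrier_of \<FF>)"
    by (rule second_countable_Hausdorff_inj_bits)
  define k where "k = (\<lambda>D :: ('r, 'f, 'c, 'd) struct. to_nat_on (carrier_of D))"
  have k: "inj_on (k D) (carrier_of D)" if "D \<in> \<F>" for D
    using fin[OF that] by (simp add: k_def countable_finite inj_on_to_nat_on)
  let ?\<F> = "(\<lambda>D. recode L (k D) D) ` \<F>" and ?\<FF> = "recode L h \<FF>"
  let ?R = "to_nat_on (rel_syms L) R"
  have E': "binary_rel_of ?\<FF> ?R = map_prod h h ` ?E"
    by (rule binary_rel_of_recode[OF L])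
  have EX: "?E \<subseteq> carrier_of \<FF> \<times> carrier_of \<FF>"
    using eqv by (rule equiv_type)
  have rel_iff: "(h x, h y) \<in> map_prod h h ` ?E \<longleftrightarrow> (x, y) \<in> ?E"
    if "x \<in> carrier_of \<FF>" "y \<in> carrier_of \<FF>" for x y
  proof
    assume "(h x, h y) \<in> map_prod h h ` ?E"
    then obtain a b where "(a, b) \<in> ?E" "h x = h a" "h y = h b" by auto
    with that EX show "(x, y) \<in> ?E"
      using inj_onD[OF h] by blast
  qed force
  have eqv': "equiv (h ` carrier_of \<FF>) (map_prod h h ` ?E)"
  proof (rule equivI)
    show "refl_on (h ` carrier_of \<FF>) (map_prod h h ` ?E)"
      using eqv by (auto simp: refl_on_def rel_iff dest: equivE elim!: equivE)
    show "sym (map_prod h h ` ?E)"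
      using eqv by (auto simp: sym_def elim!: equivE)
    show "trans (map_prod h h ` ?E)"
    proof (rule transI)
      fix x y z assume "(x, y) \<in> map_prod h h ` ?E" "(y, z) \<in> map_prod h h ` ?E"
      then obtain a b b' c where "(a, b) \<in> ?E" "(b', c) \<in> ?E" "x = h a" "y = h b" "y = h b'" "z = h c"
        by auto
      \<comment> \<open>The middle point \<open>y\<close> is decoded once from each pair;
        injectivity of \<open>h\<close> makes the two results agree, so transitivity
        applies.\<close>
      moreover from this have "b = b'"
        using EX inj_onD[OF h] by auto
      ultimately show "(x, z) \<in> map_prod h h ` ?E"
        using eqv by (auto elim!: equivE dest: transD intro!: rev_image_eqI[of "(a, c)"])
    qed
    show "map_prod h h ` ?E \<subseteq> h ` carrier_of \<FF> \<times> h ` carrier_of \<FF>"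
      using EX by auto
  qed
  have qh: "quotient_map ?X (copy_topology h ?X) h"
    using homeomorphic_maps_copy_topology[OF h] by (simp add: homeomorphic_maps_map homeomorphic_map_def)
  \<comment> \<open>Both spaces are quotients of \<open>?X\<close>, one of them by way of the
    homeomorphism \<open>h\<close>, and the two quotient maps have the same fibres.\<close>
  have "quotient_space (copy_topology h ?X) (map_prod h h ` ?E) homeomorphic_space quotient_space ?X ?E"
  proof (rule homeomorphic_space_quotient_maps)
    show "quotient_map ?X (quotient_space (copy_topology h ?X) (map_prod h h ` ?E))
        ((\<lambda>x. (map_prod h h ` ?E) `` {x}) \<circ> h)"
      by (rule quotient_map_compose[OF qh quotient_map_quotient_space])
    show "quotient_map ?X (quotient_space ?X ?E) (\<lambda>x. ?E `` {x})"
      by (rule quotient_map_quotient_space)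
    fix x y assume "x \<in> carrier_of \<FF>" "y \<in> carrier_of \<FF>"
    then show "((\<lambda>x. (map_prod h h ` ?E) `` {x}) \<circ> h) x = ((\<lambda>x. (map_prod h h ` ?E) `` {x}) \<circ> h) y
        \<longleftrightarrow> ?E `` {x} = ?E `` {y}"
      using eq_equiv_class_iff[OF eqv'] eq_equiv_class_iff[OF eqv] rel_iff by simp
  qed
  then have hom': "quotient_space (top_of ?\<FF>) (binary_rel_of ?\<FF> ?R) homeomorphic_space Y"
    unfolding E' top_of_recode using hom by (rule homeomorphic_space_trans)
  have "representable (recode_language L) ?R Y"
    unfolding representable_def
  proof (intro conjI Y exI[of _ ?\<F>] exI[of _ ?\<FF>] hom')
    show "countable ?\<F>" using cnt by simp
    show "\<forall>D\<in>?\<F>. finite (carrier_of D)" using fin by simp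
    show "projective_Fraisse_family (recode_language L) ?\<F>"
      by (rule projective_Fraisse_family_recode[OF L(1) \<F> k])
    show "projective_Fraisse_limit (recode_language L) ?\<F> ?\<FF>"
      by (rule projective_Fraisse_limit_recode[OF L(1) \<F> lim k h])
    show "equiv (carrier_of ?\<FF>) (binary_rel_of ?\<FF> ?R)"
      using eqv' by (simp add: E')
  qed
  moreover have "binary_rel_symbol (recode_language L) ?R"
    using L from_nat_into_syms(1)[OF L(1)] by (auto simp: binary_rel_symbol_def recode_language_def)
  ultimately show ?thesis
    unfolding finitely_representable_def using finite_language_recode[OF L(1)] by blast
qed

section \<open>Expansion by a binary relation\<close>

text \<open>The option type provides a symbol \<open>None\<close> that is certainly new, while the
  old symbols, the original \<open>R\<close> among them, are kept under \<open>Some\<close>.\<close>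

definition expand_language :: "('r, 'f, 'c) language \<Rightarrow> ('r option, 'f, 'c) language" where
  "expand_language L =
     \<lparr>rel_syms = insert None (Some ` rel_syms L), rel_arity = case_option 2 (rel_arity L),
      fun_syms = fun_syms L, fun_arity = fun_arity L, const_syms = const_syms L\<rparr>"

text \<open>The new relation consists of extensional pairs, matching the encoding of tuples. That
  their entries lie in the carrier is left to the choice of \<open>S\<close>, and follows where
  \<open>S\<close> is closed in the square of the space.\<close>

definition expand ::
    "('a \<times> 'a) set \<Rightarrow> ('r, 'f, 'c, 'a) struct \<Rightarrow> ('r option, 'f, 'c, 'a) struct" where
  "expand S A =
     \<lparr>top_of = top_of A,
      rel_of = case_option {a \<in> extensional {..<2}. (a 0, a 1) \<in> S} (rel_of A),
      fun_of = fun_of A, const_of = const_of A\<rparr>"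

lemma top_of_expand [simp]: "top_of (expand S A) = top_of A"
  by (simp add: expand_def)

lemma binary_tuple_image:
  fixes S :: "('a \<times> 'a) set"
  shows "(\<lambda>a. (a 0, a 1)) ` {a \<in> extensional {..<2::nat}. (a 0, a 1) \<in> S} = S"
proof (intro equalityI subsetI)
  fix p assume "p \<in> S"
  then show "p \<in> (\<lambda>a. (a 0, a 1)) ` {a \<in> extensional {..<2::nat}. (a 0, a 1) \<in> S}"
    by (intro image_eqI[of _ _ "\<lambda>i\<in>{..<2}. if i = 0 then fst p else snd p"]) auto
qed auto

lemma binary_rel_of_expand: "binary_rel_of (expand S A) None = S"
  unfolding binary_rel_of_def expand_def by (simp only: struct.simps option.case binary_tuple_image)

lemma map_tuple_binary:
  fixes S :: "('a \<times> 'a) set"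
  shows "map_tuple 2 \<phi> ` {a \<in> extensional {..<2}. (a 0, a 1) \<in> S} =
   {a \<in> extensional {..<2}. (a 0, a 1) \<in> map_prod \<phi> \<phi> ` S}"
proof (intro equalityI subsetI)
  fix b :: "nat \<Rightarrow> 'b" assume "b \<in> {a \<in> extensional {..<2}. (a 0, a 1) \<in> map_prod \<phi> \<phi> ` S}"
  then obtain u v where b: "b \<in> extensional {..<2}" "b 0 = \<phi> u" "b 1 = \<phi> v" and S: "(u, v) \<in> S"
    by auto
  let ?a = "\<lambda>i\<in>{..<2::nat}. if i = 0 then u else v"
  have "b = map_tuple 2 \<phi> ?a"
    by (rule extensionalityI[OF b(1)]) (use b in \<open>auto simp: map_tuple_def less_2_cases_iff\<close>)
  then show "b \<in> map_tuple 2 \<phi> ` {a \<in> extensional {..<2}. (a 0, a 1) \<in> S}"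
    using S by (intro image_eqI[of _ _ ?a]) auto
qed (auto simp: map_tuple_def)

text \<open>The old clauses are untouched. The clause for \<open>None\<close> is an equality of sets
  of extensional pairs, and such a set determines its underlying relation.\<close>

lemma epimorphism_expand_iff:
  "epimorphism (expand_language L) (expand S A) (expand T B) \<phi> \<longleftrightarrow>
   epimorphism L A B \<phi> \<and> T = map_prod \<phi> \<phi> ` S"
proof -
  have "{a \<in> extensional {..<2}. (a 0, a 1) \<in> T} =
      {a \<in> extensional {..<2::nat}. (a 0, a 1) \<in> map_prod \<phi> \<phi> ` S} \<longleftrightarrow> T = map_prod \<phi> \<phi> ` S"
    (is "?T = ?S \<longleftrightarrow> _")
  proof
    assume "?T = ?S"
    then have "(\<lambda>a. (a 0, a 1)) ` ?T = (\<lambda>a. (a 0, a 1)) ` ?S"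
      by (rule arg_cong)
    then show "T = map_prod \<phi> \<phi> ` S"
      by (simp only: binary_tuple_image)
  qed simp
  then have "(\<forall>r\<in>rel_syms (expand_language L). rel_of (expand T B) r =
        map_tuple (rel_arity (expand_language L) r) \<phi> ` rel_of (expand S A) r) \<longleftrightarrow>
      (\<forall>r\<in>rel_syms L. rel_of B r = map_tuple (rel_arity L r) \<phi> ` rel_of A r) \<and> T = map_prod \<phi> \<phi> ` S"
    by (simp add: expand_language_def expand_def map_tuple_binary conj_commute del: One_nat_def)
  then show ?thesis
    unfolding epimorphism_def by (simp add: expand_language_def expand_def conj_ac)
qed

lemma topological_structure_expand:
  assumes A: "topological_structure L A" and S: "closedin (prod_topology (top_of A) (top_of A)) S"
  shows "topological_structure (expand_language L) (expand S A)"
proof -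
  let ?P = "power_topology 2 (top_of A)"
  have "continuous_map ?P (prod_topology (top_of A) (top_of A)) (\<lambda>a. (a 0, a 1))"
    by (intro continuous_map_pairedI continuous_map_product_projection) auto
  then have "closedin ?P {a \<in> topspace ?P. (a 0, a 1) \<in> S}"
    using S by (rule closedin_continuous_map_preimage)
  also have "{a \<in> topspace ?P. (a 0, a 1) \<in> S} = {a \<in> extensional {..<2}. (a 0, a 1) \<in> S}"
    using closedin_subset[OF S] by (auto simp: PiE_def Pi_def less_2_cases_iff)
  finally show ?thesis
    using A by (simp add: topological_structure_def expand_language_def expand_def)
qed

text \<open>Since every epimorphism between members carries the new relation onto the new relation,
  the expansion has exactly the old epimorphisms, and JPP and AP carry over with the same
  witnesses.\<close>

lemma projective_Fraisse_family_expand: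
  assumes \<F>: "projective_Fraisse_family L \<F>"
    and closed: "\<And>D. D \<in> \<F> \<Longrightarrow> closedin (prod_topology (top_of D) (top_of D)) (S D)"
    and S: "\<And>D E \<phi>. D \<in> \<F> \<Longrightarrow> E \<in> \<F> \<Longrightarrow> epimorphism L D E \<phi> \<Longrightarrow> S E = map_prod \<phi> \<phi> ` S D"
  shows "projective_Fraisse_family (expand_language L) ((\<lambda>D. expand (S D) D) ` \<F>)"
proof -
  have epi: "epimorphism (expand_language L) (expand (S D) D) (expand (S E) E) \<phi> \<longleftrightarrow>
      epimorphism L D E \<phi>" if "D \<in> \<F>" "E \<in> \<F>" for D E \<phi>
    using S that by (auto simp: epimorphism_expand_iff)
  have ts: "topological_structure (expand_language L) (expand (S D) D)" if "D \<in> \<F>" for D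
    using \<F> that by (intro topological_structure_expand closed) (auto simp: projective_Fraisse_family_def)
  have JPP: "\<exists>F\<in>\<F>. (\<exists>\<phi>. epimorphism (expand_language L) (expand (S F) F) (expand (S D) D) \<phi>) \<and>
      (\<exists>\<psi>. epimorphism (expand_language L) (expand (S F) F) (expand (S E) E) \<psi>)"
    if "D \<in> \<F>" "E \<in> \<F>" for D E
    using \<F> that unfolding projective_Fraisse_family_def by (auto simp: epi cong: bex_cong)
  have AP: "\<exists>F\<in>\<F>. \<exists>\<psi>\<^sub>1 \<psi>\<^sub>2. epimorphism (expand_language L) (expand (S F) F) (expand (S D) D) \<psi>\<^sub>1 \<and>
      epimorphism (expand_language L) (expand (S F) F) (expand (S E) E) \<psi>\<^sub>2 \<and>
      (\<forall>x\<in>carrier_of F. \<phi>\<^sub>1 (\<psi>\<^sub>1 x) = \<phi>\<^sub>2 (\<psi>\<^sub>2 x))"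
    if "C \<in> \<F>" "D \<in> \<F>" "E \<in> \<F>" "epimorphism (expand_language L) (expand (S D) D) (expand (S C) C) \<phi>\<^sub>1"
      "epimorphism (expand_language L) (expand (S E) E) (expand (S C) C) \<phi>\<^sub>2" for C D E \<phi>\<^sub>1 \<phi>\<^sub>2
    using \<F> that unfolding projective_Fraisse_family_def by (simp add: epi cong: bex_cong)
  show ?thesis
    unfolding projective_Fraisse_family_def ball_simps(9) bex_simps(7) top_of_expand
    by (intro conjI ballI allI impI; (elim conjE)?; rule ts JPP AP; assumption)
qed

text \<open>The compatibility of \<open>S\<close> with \<open>E\<close> keeps all epimorphisms to
  members, which settles (L1) and (L2). For (L3) the automorphisms supplied must also respect
  \<open>E\<close>, which is what \<open>inv\<close> guarantees.\<close>

lemma projective_Fraisse_limit_expand: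
  assumes lim: "projective_Fraisse_limit L \<F> \<FF>"
    and closed: "closedin (prod_topology (top_of \<FF>) (top_of \<FF>)) E"
    and S: "\<And>D \<phi>. D \<in> \<F> \<Longrightarrow> epimorphism L \<FF> D \<phi> \<Longrightarrow> S D = map_prod \<phi> \<phi> ` E"
    and inv: "\<And>\<psi>. isomorphism L \<FF> \<FF> \<psi> \<Longrightarrow> map_prod \<psi> \<psi> ` E = E"
  shows "projective_Fraisse_limit (expand_language L) ((\<lambda>D. expand (S D) D) ` \<F>) (expand E \<FF>)"
proof -
  have epi: "epimorphism (expand_language L) (expand E \<FF>) (expand (S D) D) \<phi> \<longleftrightarrow>
      epimorphism L \<FF> D \<phi>" if "D \<in> \<F>" for D \<phi>
    using S that by (auto simp: epimorphism_expand_iff)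
  have iso: "isomorphism (expand_language L) (expand E \<FF>) (expand E \<FF>) \<psi> \<longleftrightarrow> isomorphism L \<FF> \<FF> \<psi>" for \<psi>
    using inv[of \<psi>] by (auto simp: isomorphism_def epimorphism_expand_iff)
  have ts: "topological_structure (expand_language L) (expand E \<FF>)"
    using lim by (intro topological_structure_expand closed) (simp add: projective_Fraisse_limit_def)
  have L1: "\<exists>\<phi>. epimorphism (expand_language L) (expand E \<FF>) (expand (S D) D) \<phi>" if "D \<in> \<F>" for D
    using lim that unfolding projective_Fraisse_limit_def by (simp add: epi)
  have L2: "\<exists>D\<in>\<F>. \<exists>\<phi> f'. epimorphism (expand_language L) (expand E \<FF>) (expand (S D) D) \<phi> \<and>
      f' \<in> carrier_of D \<rightarrow> A \<and> (\<forall>x\<in>carrier_of \<FF>. f x = f' (\<phi> x))"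
    if "finite A" "continuous_map (top_of \<FF>) (discrete_topology A) f" for A :: "nat set" and f
    using lim that unfolding projective_Fraisse_limit_def by (simp add: epi cong: bex_cong)
  have L3: "\<exists>\<psi>. isomorphism (expand_language L) (expand E \<FF>) (expand E \<FF>) \<psi> \<and>
      (\<forall>x\<in>carrier_of \<FF>. \<phi>\<^sub>2 x = \<phi>\<^sub>1 (\<psi> x))"
    if "D \<in> \<F>" "epimorphism (expand_language L) (expand E \<FF>) (expand (S D) D) \<phi>\<^sub>1"
      "epimorphism (expand_language L) (expand E \<FF>) (expand (S D) D) \<phi>\<^sub>2" for D \<phi>\<^sub>1 \<phi>\<^sub>2
    using lim that unfolding projective_Fraisse_limit_def by (simp add: epi iso)
  show ?thesis
    unfolding projective_Fraisse_limit_def ball_simps(9) bex_simps(7) top_of_expand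
    by (intro conjI ballI allI impI ts; (elim conjE)?; rule L1 L2 L3; assumption)
qed

section \<open>Automorphism invariance of the gluing relation\<close>

lemma isomorphism_preserves_gluing:
  assumes A: "topological_structure L A" and R: "binary_rel_symbol L R" and E: "equiv (carrier_of A) E"
    and RE: "binary_rel_of A R \<subseteq> E"
    and glue: "E - {x. almost_stable L R A x} \<times> {x. almost_stable L R A x} \<subseteq> binary_rel_of A R"
    and \<psi>: "isomorphism L A A \<psi>"
  shows "map_prod \<psi> \<psi> ` E = E"
proof -
  \<comment> \<open>The inclusion is shown for all automorphisms, so that it can be applied to
    \<open>\<psi>\<close> and to its inverse.\<close>
  have sub: "map_prod \<theta> \<theta> ` E \<subseteq> E" if \<theta>: "isomorphism L A A \<theta>" for \<theta>
  proof (rule image_subsetI)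
    fix p assume "p \<in> E"
    then obtain u v where p: "p = (u, v)" and uv: "(u, v) \<in> E"
      by (cases p) auto
    have "map_prod \<theta> \<theta> (u, v) \<in> E"
    proof (cases "almost_stable L R A u \<and> almost_stable L R A v")
      case True
      \<comment> \<open>Almost stability relates each point to its image by \<open>R\<close>, hence
        by \<open>E\<close>, so both ends of the pair may be moved within their classes.\<close>
      then have "(\<theta> u, u) \<in> E" "(\<theta> v, v) \<in> E"
        using \<theta> RE by (auto simp: almost_stable_def)
      then show ?thesis
        using uv E by (simp, meson equivE symE transE)
    next
      case False
      \<comment> \<open>Outside the square of the almost stable points the pair already belongs to
        \<open>R\<close>, which \<open>\<theta>\<close> preserves.\<close>
      then obtain a where a: "a \<in> rel_of A R" "u = a 0" "v = a 1"
        using uv glue by (auto simp: binary_rel_of_def)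
      have "map_tuple 2 \<theta> a \<in> rel_of A R"
        using a(1) \<theta> R unfolding isomorphism_def epimorphism_def binary_rel_symbol_def
        by (metis imageI)
      then have "(\<theta> u, \<theta> v) \<in> binary_rel_of A R"
        unfolding binary_rel_of_def a by (rule rev_image_eqI) (simp add: map_tuple_def)
      then show ?thesis
        using RE by auto
    qed
    then show "map_prod \<theta> \<theta> p \<in> E"
      by (simp add: p)
  qed
  let ?g = "inv_into (carrier_of A) \<psi>"
  have EA: "E \<subseteq> carrier_of A \<times> carrier_of A"
    using E by (rule equiv_type)
  have "map_prod \<psi> \<psi> ` map_prod ?g ?g ` E = (\<lambda>p. p) ` E"
    unfolding image_image
    by (rule image_cong[OF refl])
      (use EA \<psi> in \<open>auto simp: isomorphism_def bij_betw_def f_inv_into_f\<close>)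
  then have "E \<subseteq> map_prod \<psi> \<psi> ` E"
    using sub[OF isomorphism_inv_into[OF A \<psi>]] by (metis image_ident image_mono)
  with sub[OF \<psi>] show ?thesis by blast
qed

section \<open>The relation induced on the family, and the quotient by \<open>E\<close> as a
  quotient of \<open>X\<close>\<close>

theorem theorem4p4:
  fixes X :: "'x set" and d :: "'x \<Rightarrow> 'x \<Rightarrow> real"
    and L :: "('r, 'f, 'c) language" and R :: 'r
    and \<F> :: "('r, 'f, 'c, 'd) struct set"
    and \<FF> :: "('r, 'f, 'c, 'a) struct"
    and \<Phi> :: "'x \<Rightarrow> 'a set" and \<pi> :: "'a \<Rightarrow> 'a set"
    and RF :: "('a \<times> 'a) set" and G :: "'a set"
    and E :: "('a \<times> 'a) set" and C :: "('x \<times> 'x) set"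
  assumes "Metric_space X d"
    and "compact_space (Metric_space.mtopology X d)"
    and "finite_language L" and "binary_rel_symbol L R"
    and "countable \<F>" and "\<forall>D\<in>\<F>. finite (carrier_of D)"
    and "projective_Fraisse_family L \<F>"
    and "projective_Fraisse_limit L \<F> \<FF>"
    and "RF = binary_rel_of \<FF> R"
    and "equiv (carrier_of \<FF>) RF"
    and "homeomorphic_map (Metric_space.mtopology X d) (quotient_space (top_of \<FF>) RF) \<Phi>"
    and "\<pi> = (\<lambda>u. RF `` {u})"
    and "G = {x. almost_stable L R \<FF> x}"
    and "equiv (carrier_of \<FF>) E"
    and "closedin (prod_topology (top_of \<FF>) (top_of \<FF>)) E"
    and "RF \<subseteq> E"
    and "E - G \<times> G = RF - G \<times> G"
    and "C = {(x, y). x \<in> X \<and> y \<in> X \<and>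
               (\<exists>u\<in>carrier_of \<FF>. \<exists>v\<in>carrier_of \<FF>. (u, v) \<in> E \<and> \<pi> u = \<Phi> x \<and> \<pi> v = \<Phi> y)}"
  shows "finitely_representable (quotient_space (Metric_space.mtopology X d) C)"
proof -
  let ?M = "Metric_space.mtopology X d" and ?T = "top_of \<FF>"
  note R = assms(4) and fin = assms(6) and \<F> = assms(7) and lim = assms(8)
    and RF = assms(9) and eqvR = assms(10) and \<Phi> = assms(11) and \<pi> = assms(12)
    and eqvE = assms(14) and closed = assms(15) and RE = assms(16)
  have tM: "topspace ?M = X"
    using assms(1) by (rule Metric_space.topspace_mtopology)
  have tF: "topological_structure L \<FF>"
    using lim by (simp add: projective_Fraisse_limit_def)
  have T: "compact_space ?T" "Hausdorff_space ?T" "second_countable ?T"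
    using tF by (auto simp: topological_structure_def)
  have preserve: "map_prod \<psi> \<psi> ` E = E" if "isomorphism L \<FF> \<FF> \<psi>" for \<psi>
    using assms(13,17) RE RF
    by (intro isomorphism_preserves_gluing[OF tF R eqvE _ _ that]) auto

  \<comment> \<open>An arbitrary epimorphism onto \<open>D\<close> is used; (L1) provides one for
    members of \<open>\<F>\<close>, and the next fact shows that the choice does not matter.\<close>
  define S where "S = (\<lambda>D :: ('r, 'f, 'c, 'd) struct. map_prod (SOME \<phi>. epimorphism L \<FF> D \<phi>) (SOME \<phi>. epimorphism L \<FF> D \<phi>) ` E)"
  have S: "S D = map_prod \<phi> \<phi> ` E" if D: "D \<in> \<F>" and \<phi>: "epimorphism L \<FF> D \<phi>" for D \<phi>
  proof -
    let ?\<phi> = "SOME \<phi>. epimorphism L \<FF> D \<phi>"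
    have "epimorphism L \<FF> D ?\<phi>"
      by (rule someI[of "epimorphism L \<FF> D", OF \<phi>])
    then obtain \<psi> where \<psi>: "isomorphism L \<FF> \<FF> \<psi>" "\<And>x. x \<in> carrier_of \<FF> \<Longrightarrow> ?\<phi> x = \<phi> (\<psi> x)"
      using projective_Fraisse_limit_homogeneous[OF lim D \<phi>] by blast
    \<comment> \<open>The chosen epimorphism is \<open>\<phi>\<close> after the automorphism
      \<open>\<psi>\<close>, and \<open>\<psi>\<close> maps \<open>E\<close> onto itself.\<close>
    have "S D = map_prod \<phi> \<phi> ` map_prod \<psi> \<psi> ` E"
      unfolding S_def image_image
      by (rule image_cong[OF refl]) (use equiv_type[OF eqvE] \<psi>(2) in auto)
    then show ?thesis
      using preserve[OF \<psi>(1)] by simp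
  qed
  \<comment> \<open>Composing \<open>\<alpha>\<close> with an epimorphism from the limit to
    \<open>D\<close> gives an epimorphism from the limit to \<open>D'\<close>, by which
    \<open>S D'\<close> may be computed.\<close>
  have S_epi: "S D' = map_prod \<alpha> \<alpha> ` S D"
    if D: "D \<in> \<F>" "D' \<in> \<F>" and \<alpha>: "epimorphism L D D' \<alpha>" for D D' \<alpha>
  proof -
    obtain \<phi> where \<phi>: "epimorphism L \<FF> D \<phi>"
      using lim D(1) by (auto simp: projective_Fraisse_limit_def)
    have "S D' = map_prod (\<alpha> \<circ> \<phi>) (\<alpha> \<circ> \<phi>) ` E"
      by (rule S[OF D(2) epimorphism_compose[OF \<phi> \<alpha>]])
    also have "\<dots> = map_prod \<alpha> \<alpha> ` S D"
      unfolding S[OF D(1) \<phi>] image_comp map_prod_compose ..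
    finally show ?thesis .
  qed
  have S_closed: "closedin (prod_topology (top_of D) (top_of D)) (S D)" if D: "D \<in> \<F>" for D
  proof -
    obtain \<phi> where \<phi>: "epimorphism L \<FF> D \<phi>"
      using lim D by (auto simp: projective_Fraisse_limit_def)
    have sub: "S D \<subseteq> carrier_of D \<times> carrier_of D"
      using \<phi> equiv_type[OF eqvE] unfolding S[OF D \<phi>] by (auto simp: epimorphism_def)
    moreover have "finite (S D)"
      by (rule finite_subset[OF sub]) (use fin D in auto)
    moreover have "Hausdorff_space (prod_topology (top_of D) (top_of D))"
      using \<F> D by (simp add: projective_Fraisse_family_def topological_structure_def
          Hausdorff_space_prod_topology)
    ultimately show ?thesis
      by (auto simp: closedin_Hausdorff_finite_eq)
  qed

  obtain \<Psi> where \<Psi>: "homeomorphic_maps ?M (quotient_space ?T RF) \<Phi> \<Psi>"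
    using \<Phi> homeomorphic_map_maps by blast
  \<comment> \<open>This presents \<open>X\<close> as a quotient of the limit, so that points of
    \<open>X\<close> can be handled through representatives.\<close>
  define p where "p = \<Psi> \<circ> (\<lambda>u. RF `` {u})"
  have qp: "quotient_map ?T ?M p"
    unfolding p_def
    using \<Psi> by (intro quotient_map_compose[OF quotient_map_quotient_space])
      (simp add: homeomorphic_maps_map homeomorphic_map_def)
  have \<Phi>p: "\<Phi> (p u) = RF `` {u}" if "u \<in> carrier_of \<FF>" for u
    using \<Psi> quotientI[OF that, of RF] by (simp add: p_def homeomorphic_maps_def topspace_quotient_space)
  have pX: "p ` carrier_of \<FF> = X"
    using quotient_imp_surjective_map[OF qp] tM by simp
  have C_iff: "(p u, p v) \<in> C \<longleftrightarrow> (u, v) \<in> E" if uv: "u \<in> carrier_of \<FF>" "v \<in> carrier_of \<FF>" for u v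
  proof
    assume "(p u, p v) \<in> C"
    then obtain a b where "a \<in> carrier_of \<FF>" "b \<in> carrier_of \<FF>" "(a, b) \<in> E"
        "RF `` {a} = RF `` {u}" "RF `` {b} = RF `` {v}"
      using uv \<Phi>p by (auto simp: assms(18) \<pi>)
    \<comment> \<open>The witnesses \<open>a\<close> and \<open>b\<close> are only
      \<open>R\<close>-equivalent to \<open>u\<close> and \<open>v\<close>; the inclusion of
      \<open>RF\<close> in \<open>E\<close> absorbs the difference.\<close>
    then have "(a, u) \<in> E" "(a, b) \<in> E" "(b, v) \<in> E"
      using eq_equiv_class_iff[OF eqvR] uv RE by auto
    then show "(u, v) \<in> E"
      using eqvE by (meson equivE symE transE)
  next
    assume "(u, v) \<in> E"
    then show "(p u, p v) \<in> C"
      using uv \<Phi>p pX by (auto simp: assms(18) \<pi>)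
  qed
  have eqvC: "equiv X C"
  proof (rule equivI)
    show "C \<subseteq> X \<times> X"
      by (auto simp: assms(18))
    show "refl_on X C"
      unfolding refl_on_def pX[symmetric] using C_iff eqvE by (auto elim!: equivE dest: refl_onD)
    show "sym C"
    proof (rule symI)
      fix x y assume xy: "(x, y) \<in> C"
      with \<open>C \<subseteq> X \<times> X\<close> obtain u v where "u \<in> carrier_of \<FF>" "v \<in> carrier_of \<FF>" "x = p u" "y = p v"
        unfolding pX[symmetric] by blast
      with xy C_iff eqvE show "(y, x) \<in> C"
        by (metis equivE symE)
    qed
    show "trans C"
    proof (rule transI)
      fix x y z assume xyz: "(x, y) \<in> C" "(y, z) \<in> C"
      then have "x \<in> X" "y \<in> X" "z \<in> X"
        using \<open>C \<subseteq> X \<times> X\<close> by auto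
      then obtain u v w where "u \<in> carrier_of \<FF>" "v \<in> carrier_of \<FF>" "w \<in> carrier_of \<FF>"
          "x = p u" "y = p v" "z = p w"
        unfolding pX[symmetric] by blast
      with xyz show "(x, z) \<in> C"
        using C_iff equivE[OF eqvE] by (metis transD)
    qed
  qed
  \<comment> \<open>Both sides are quotients of the limit, and \<open>C_iff\<close> says that their
    quotient maps have the same fibres.\<close>
  have hom: "quotient_space ?T E homeomorphic_space quotient_space ?M C"
  proof (rule homeomorphic_space_quotient_maps)
    show "quotient_map ?T (quotient_space ?T E) (\<lambda>u. E `` {u})"
      by (rule quotient_map_quotient_space)
    show "quotient_map ?T (quotient_space ?M C) ((\<lambda>x. C `` {x}) \<circ> p)"
      by (rule quotient_map_compose[OF qp quotient_map_quotient_space])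
    fix u v assume uv: "u \<in> carrier_of \<FF>" "v \<in> carrier_of \<FF>"
    then have "p u \<in> X" "p v \<in> X"
      using pX by auto
    then show "E `` {u} = E `` {v} \<longleftrightarrow> ((\<lambda>x. C `` {x}) \<circ> p) u = ((\<lambda>x. C `` {x}) \<circ> p) v"
      using uv by (simp add: eq_equiv_class_iff[OF eqvE] eq_equiv_class_iff[OF eqvC] C_iff)
  qed
  have "quotient_map ?T (quotient_space ?T E) (\<lambda>u. E `` {u})"
    by (rule quotient_map_quotient_space)
  then have q: "continuous_map ?T (quotient_space ?T E) (\<lambda>u. E `` {u})"
      "(\<lambda>u. E `` {u}) ` carrier_of \<FF> = topspace (quotient_space ?T E)"
    by (auto intro: quotient_imp_continuous_map dest: quotient_imp_surjective_map)
  \<comment> \<open>The quotient of the limit by the closed relation \<open>E\<close> is a Hausdorff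
    image of a compact second countable space. Metrizability and compactness then reach the quotient
    of \<open>X\<close> through \<open>hom\<close>.\<close>
  have "metrizable_space (quotient_space ?T E)"
    by (rule metrizable_space_continuous_image[OF q T(1,3)
          Hausdorff_space_quotient_space[OF T(1,2) eqvE closed]])
  moreover have "compact_space (quotient_space ?T E)"
    using q T(1) by (metis compact_space_def image_compactin)
  ultimately have Y: "compact_space (quotient_space ?M C)" "metrizable_space (quotient_space ?M C)"
    using homeomorphic_compact_space[OF hom] homeomorphic_metrizable_space[OF hom] by auto
  show ?thesis
  \<comment> \<open>The distinguished symbol is now \<open>None\<close>, whose interpretation in the
    expanded limit is \<open>E\<close>; one added symbol keeps the language finite.\<close>
  proof (rule finitely_representableI)
    show "finite_language (expand_language L)"
      using assms(3) by (simp add: finite_language_def expand_language_def)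
    show "binary_rel_symbol (expand_language L) None"
      by (simp add: binary_rel_symbol_def expand_language_def)
    show "countable ((\<lambda>D. expand (S D) D) ` \<F>)"
      using assms(5) by simp
    show "projective_Fraisse_family (expand_language L) ((\<lambda>D. expand (S D) D) ` \<F>)"
      by (rule projective_Fraisse_family_expand[OF \<F> S_closed S_epi])
    show "projective_Fraisse_limit (expand_language L) ((\<lambda>D. expand (S D) D) ` \<F>) (expand E \<FF>)"
      by (rule projective_Fraisse_limit_expand[OF lim closed S preserve])
  qed (use fin hom eqvE Y in \<open>auto simp: binary_rel_of_expand\<close>)
qed

end
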